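(* Let $\{X_n, n\ge 0\}$ be a countable nonhomogeneous Markov chain taking values in $S=\{1,2,\ldots\}$ with initial distribution $\mu^{(0)}=(\mu(1),\mu(2),\ldots)$ and transition matrices $P_n=(p_n(i,j))_{i,j\in S}$, $n\ge 1$, where $p_n(i,j)=\mathbb{P}(X_n=j\mid X_{n-1}=i)$. Let $f:\mathbb{R}\to\mathbb{R}$ be a function satisfying $|f(x)|\le M$ for all $x\in\mathbb{R}$, for some constant $M$. Let $P=(p(i,j))_{i,j\in S}$ be a periodic strongly ergodic stochastic matrix, and let $R$ be a constant stochastic matrix each row of which is the left eigenvector $\pi=(\pi(1),\pi(2),\ldots)$ of $P$ satisfying $\pi P=\pi$ and $\sum_{i\in S}\pi(i)=1$. Assume that $$\lim_{n\to\infty}\sup_{m\ge 0}\frac1n\sum_{k=1}^{n}\|P_{k+m}-P\|=0,$$ $$\theta:=\sum_{i\in S}\pi(i)\Big[f^2(i)-\Big(\sum_{j\in S}f(j)p(i,j)\Big)^2\Big]>0,$$ and $$\lim_{n\to\infty}\frac{\sum_{k=1}^{n}\delta(P_k)}{\sqrt n}=0.$$ Let $(a(n))_{n\ge 1}$ be a sequence of real numbers with $$\lim_{n\to\infty}\frac{a(n)}{\sqrt n}=\infty,\qquad \lim_{n\to\infty}\frac{a(n)}{n}=0.$$ Let $S_n=\sum_{k=1}^{n}f(X_k)$ and $I(x)=\frac{x^2}{2\theta}$ for $x\in\mathbb{R}$. Then for each open set $G\subset\mathbb{R}$, $$\liminf_{n\to\infty}\frac{n}{a^2(n)}\log\mathbb{P}\left\{\frac{S_n-E(S_n)}{a(n)}\in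 G\right\}\ge-\inf_{x\in G}I(x),$$ and for each closed set $F\subset\mathbb{R}$, $$\limsup_{n\to\infty}\frac{n}{a^2(n)}\log\mathbb{P}\left\{\frac{S_n-E(S_n)}{a(n)}\in F\right\}\le-\inf_{x\in F}I(x).$$
   Context: For a matrix $A=(a_{ij})$ indexed by $S\times S$, $\|A\|=\sup_{i\in S}\sum_{j\in S}|a_{ij}|$. For a stochastic matrix $Q=(q(i,j))_{i,j\in S}$, $\delta(Q)=\sup_{i,k\in S}\sum_{j\in S}[q(i,j)-q(k,j)]^+$, where $[a]^+=\max\{0,a\}$. A stochastic matrix is called constant if all its rows are equal. Conventions: $\log 0=-\infty$ and $\inf\emptyset=+\infty$. Strong ergodicity: a sequence of stochastic matrices $\{P_n,n\ge 1\}$ is strongly ergodic (with constant stochastic matrix $R$) if for all $m\ge 0$, $\lim_{n\to\infty}\|P_{m+1}P_{m+2}\cdots P_{m+n}-R\|=0$. A single stochastic matrix $T$ is strongly ergodic if the sequence with all terms equal to $T$ is, i.e. $\|T^n-R\|\to 0$ for some constant stochastic matrix $R$ (with index set and norm those of $T$). Periodic strong ergodicity: an irreducible stochastic matrix $P$ on $S$ of period $d\ge 1$ divides $S$ into $d$ disjoint subspaces (cyclic classes) $C_0,C_1,\ldots,C_{d-1}$, and $P^d$ gives $d$ stochastic matrices $T_0,\ldots,T_{d-1}$, where $T_l$ is the restriction of $P^d$ to $C_l$. The matrix $P$ is called periodic strongly ergodic if it is irreducible of some period $d\ge 1$ and $T_l$ is strongly ergodic for every $l=0,1,\ldots,d-1$.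 *)

theory Defs
  imports "HOL-Probability.Probability"
begin

abbreviation states :: "nat set" where
  "states \<equiv> {1..}"

text \<open>
  A matrix indexed by \<open>I \<times> I\<close> is a function of type \<^typ>\<open>nat \<Rightarrow> nat \<Rightarrow> real\<close> of which only
  the entries with both indices in \<open>I\<close> matter. In particular, the restriction of a matrix to a
  subset \<open>J\<close> of \<open>I\<close> is the same function, considered with the index set \<open>J\<close>.
\<close>

type_synonym mat = "nat \<Rightarrow> nat \<Rightarrow> real"

definition stochastic_mat :: "nat set \<Rightarrow> mat \<Rightarrow> bool" where
  "stochastic_mat I A \<longleftrightarrow>
     (\<forall>i\<in>I. (\<forall>j\<in>I. 0 \<le> A i j) \<and> ((\<lambda>j. A i j) has_sum 1) I)"

definition constant_mat :: "nat set \<Rightarrow> mat \<Rightarrow> bool" where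
  "constant_mat I A \<longleftrightarrow> (\<forall>i\<in>I. \<forall>k\<in>I. \<forall>j\<in>I. A i j = A k j)"

text \<open>
  The supremum below is real-valued. It is only used for differences of stochastic matrices,
  whose absolute row sums are at most 2; likewise, the sums in \<open>ergodic_coeff\<close> are at most 1.
\<close>

definition mat_norm :: "nat set \<Rightarrow> mat \<Rightarrow> real" where
  "mat_norm I A = (SUP i\<in>I. \<Sum>\<^sub>\<infinity>j\<in>I. \<bar>A i j\<bar>)"

definition ergodic_coeff :: "nat set \<Rightarrow> mat \<Rightarrow> real" where
  "ergodic_coeff I Q = (SUP (i, k)\<in>I \<times> I. \<Sum>\<^sub>\<infinity>j\<in>I. max 0 (Q i j - Q k j))"

definition mat_diff :: "mat \<Rightarrow> mat \<Rightarrow> mat" where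
  "mat_diff A B = (\<lambda>i j. A i j - B i j)"

definition mat_mult :: "nat set \<Rightarrow> mat \<Rightarrow> mat \<Rightarrow> mat" where
  "mat_mult I A B = (\<lambda>i j. \<Sum>\<^sub>\<infinity>k\<in>I. A i k * B k j)"

text \<open>\<open>mat_prod I Q m n\<close> is the product \<open>Q (m+1) \<cdots> Q (m+n)\<close>.\<close>

primrec mat_prod :: "nat set \<Rightarrow> (nat \<Rightarrow> mat) \<Rightarrow> nat \<Rightarrow> nat \<Rightarrow> mat" where
  "mat_prod I Q m 0 = (\<lambda>i j. if i = j then 1 else 0)"
| "mat_prod I Q m (Suc n) = mat_mult I (mat_prod I Q m n) (Q (m + Suc n))"

definition mat_power :: "nat set \<Rightarrow> mat \<Rightarrow> nat \<Rightarrow> mat" where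
  "mat_power I A n = mat_prod I (\<lambda>_. A) 0 n"

definition strongly_ergodic_seq :: "nat set \<Rightarrow> (nat \<Rightarrow> mat) \<Rightarrow> mat \<Rightarrow> bool" where
  "strongly_ergodic_seq I Q R \<longleftrightarrow>
     (\<forall>n\<ge>1. stochastic_mat I (Q n)) \<and> stochastic_mat I R \<and> constant_mat I R \<and>
     (\<forall>m. (\<lambda>n. mat_norm I (mat_diff (mat_prod I Q m n) R)) \<longlonglongrightarrow> 0)"

definition strongly_ergodic :: "nat set \<Rightarrow> mat \<Rightarrow> bool" where
  "strongly_ergodic I T \<longleftrightarrow> (\<exists>R. strongly_ergodic_seq I (\<lambda>_. T) R)"

definition irreducible_mat :: "nat set \<Rightarrow> mat \<Rightarrow> bool" where
  "irreducible_mat I A \<longleftrightarrow> (\<forall>i\<in>I. \<forall>j\<in>I. \<exists>n\<ge>1. mat_power I A n i j > 0)"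

definition has_period :: "nat set \<Rightarrow> mat \<Rightarrow> nat \<Rightarrow> bool" where
  "has_period I A d \<longleftrightarrow> (\<forall>i\<in>I. Gcd {n. n \<ge> 1 \<and> mat_power I A n i i > 0} = d)"

text \<open>
  For an irreducible matrix of period \<open>d\<close>, the family \<open>C 0, \<dots>, C (d - 1)\<close> exists and is unique
  up to a cyclic shift of the indices.
\<close>

definition cyclic_classes :: "nat set \<Rightarrow> mat \<Rightarrow> nat \<Rightarrow> (nat \<Rightarrow> nat set) \<Rightarrow> bool" where
  "cyclic_classes I A d C \<longleftrightarrow>
     (\<Union>l<d. C l) = I \<and> disjoint_family_on C {..<d} \<and> (\<forall>l<d. C l \<noteq> {}) \<and>
     (\<forall>l<d. \<forall>i\<in>C l. \<forall>j\<in>I. A i j > 0 \<longrightarrow> j \<in> C (Suc l mod d))"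

definition periodic_strongly_ergodic :: "nat set \<Rightarrow> mat \<Rightarrow> bool" where
  "periodic_strongly_ergodic I A \<longleftrightarrow>
     stochastic_mat I A \<and> irreducible_mat I A \<and>
     (\<exists>d\<ge>1. has_period I A d \<and>
        (\<exists>C. cyclic_classes I A d C \<and>
             (\<forall>l<d. strongly_ergodic (C l) (mat_power I A d))))"

text \<open>
  The elementary conditional probabilities are only constrained when the conditioning event has
  positive probability; elsewhere, the rows of \<open>Q n\<close> are arbitrary probability vectors.
\<close>

definition markov_chain ::
    "'a measure \<Rightarrow> (nat \<Rightarrow> 'a \<Rightarrow> nat) \<Rightarrow> (nat \<Rightarrow> real) \<Rightarrow> (nat \<Rightarrow> mat) \<Rightarrow> bool" where
  "markov_chain M X \<mu> Q \<longleftrightarrow>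
     prob_space M \<and>
     (\<forall>n. X n \<in> M \<rightarrow>\<^sub>M count_space states) \<and>
     (\<forall>n\<ge>1. stochastic_mat states (Q n)) \<and>
     (\<forall>i\<in>states. \<P>(\<omega> in M. X 0 \<omega> = i) = \<mu> i) \<and>
     (\<forall>n\<ge>1. \<forall>x. (\<forall>k\<le>n. x k \<in> states) \<longrightarrow> \<P>(\<omega> in M. \<forall>k<n. X k \<omega> = x k) > 0 \<longrightarrow>
        \<P>(\<omega> in M. X n \<omega> = x n \<bar> \<forall>k<n. X k \<omega> = x k) =
        \<P>(\<omega> in M. X n \<omega> = x n \<bar> X (n - 1) \<omega> = x (n - 1))) \<and>
     (\<forall>n\<ge>1. \<forall>i\<in>states. \<forall>j\<in>states. \<P>(\<omega> in M. X (n - 1) \<omega> = i) > 0 \<longrightarrow>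
        \<P>(\<omega> in M. X n \<omega> = j \<bar> X (n - 1) \<omega> = i) = Q n i j)"

definition partial_sum :: "(real \<Rightarrow> real) \<Rightarrow> (nat \<Rightarrow> 'a \<Rightarrow> nat) \<Rightarrow> nat \<Rightarrow> 'a \<Rightarrow> real" where
  "partial_sum f X n \<omega> = (\<Sum>k=1..n. f (real (X k \<omega>)))"

text \<open>On the nonnegative reals, this is the logarithm with the convention \<open>log 0 = -\<infinity>\<close>.\<close>

definition elog :: "real \<Rightarrow> ereal" where
  "elog p = (if p = 0 then -\<infinity> else ereal (ln p))"

definition rate_fun :: "real \<Rightarrow> real \<Rightarrow> real" where
  "rate_fun \<theta> x = x\<^sup>2 / (2 * \<theta>)"

end

theory Submission
  imports Defs
begin

text \<open>
  Two of the limits decide the structure of the problem. For every \<open>k\<close>, the entries of any two rows of \<open>P\<close>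
  in the same column differ by at most \<open>2 \<delta>(P\<^sub>k) + 2 \<parallel>P\<^sub>k - P\<parallel>\<close>, and the averages of both terms tend to
  \<open>0\<close>; so all rows of \<open>P\<close> coincide, hence equal \<open>\<pi>\<close>, and \<open>\<theta>\<close> is the variance of \<open>f\<close> under \<open>\<pi>\<close>
  (lemmas \<open>averages_tendsto_0_imp_equal_rows\<close> and \<open>theta_eq_variance\<close>). The chain therefore behaves
  like a sequence of independent variables with law \<open>\<pi>\<close>, with two kinds of errors: the conditional law
  of \<open>X\<^sub>k\<close> differs from \<open>\<pi>\<close> by at most \<open>\<epsilon>\<^sub>k = \<parallel>P\<^sub>k - P\<parallel>\<close>, and the conditional mean of \<open>f(X\<^sub>k)\<close> differs from the mean
  \<open>m\<^sub>k = E f(X\<^sub>k)\<close> by at most a multiple of \<open>\<delta>\<^sub>k = \<delta>(P\<^sub>k)\<close>.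

  The sums are therefore centred term by term with the deterministic constants \<open>m\<^sub>k\<close>. For small \<open>t\<close>, a
  second-order expansion shows that the conditional expectation of \<open>exp (t (f(X\<^sub>k) - m\<^sub>k))\<close> given
  \<open>X\<^bsub>k-1\<^esub>\<close> is, whatever the state \<open>X\<^bsub>k-1\<^esub>\<close> is, equal to \<open>1 + t\<^sup>2 \<theta> / 2\<close> up to a multiple of
  \<open>|t| \<delta>\<^sub>k + t\<^sup>2 \<epsilon>\<^sub>k + |t|\<^sup>3\<close> (\<open>pmf_mgf_estimate\<close>).
  Because the bound is uniform in the state, the Markov property multiplies these factors
  (\<open>expectation_prod_bounds\<close>), and the logarithm of \<open>E exp (t (S\<^sub>n - E S\<^sub>n))\<close> is
  \<open>n t\<^sup>2 \<theta> / 2\<close> up to \<open>|t| \<Sum>\<delta>\<^sub>k + t\<^sup>2 \<Sum>\<epsilon>\<^sub>k + n |t|\<^sup>3\<close> (\<open>centered_log_mgf_estimate\<close>). With \<open>t = l a(n) / n\<close>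
  and after division by the speed \<open>a(n)\<^sup>2 / n\<close>, the main term is \<open>\<theta> l\<^sup>2 / 2\<close>, and the three errors are
  controlled by \<open>(\<Sum>\<delta>\<^sub>k / \<surd>n) / (a(n) / \<surd>n)\<close>, \<open>\<Sum>\<epsilon>\<^sub>k / n\<close> and \<open>a(n) / n\<close>, which all tend to \<open>0\<close>.

  Convergence of the scaled logarithmic moment generating functions to a quadratic yields the two
  large deviation bounds, by the argument of Gaertner and Ellis: the exponential Markov
  inequality for closed sets and an exponential change of measure for open sets.
\<close>

section \<open>Large deviations from a quadratic limit of log moment generating functions\<close>

lemma scaled_elog_le:
  assumes "b > 0" "0 \<le> p" "p \<le> exp (b * v)"
  shows "ereal (1 / b) * elog p \<le> ereal v"
proof (cases "p = 0")
  case False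
  have "ln p \<le> b * v" using assms False by (metis less_eq_real_def ln_le_cancel_iff ln_exp exp_gt_zero)
  then show ?thesis using False assms by (simp add: elog_def field_simps)
qed (use assms in \<open>simp add: elog_def\<close>)

lemma scaled_elog_ge:
  assumes "b > 0" "exp (b * v) \<le> p"
  shows "ereal v \<le> ereal (1 / b) * elog p"
proof -
  have "p > 0" using assms(2) exp_gt_zero[of "b * v"] by linarith
  then have "b * v \<le> ln p" using assms by (simp add: ln_ge_iff)
  then show ?thesis using \<open>p > 0\<close> assms by (simp add: elog_def field_simps)
qed

context prob_space
begin

text \<open>The exponential Markov inequality on both sides at once: where \<open>\<bar>Z\<bar> \<ge> r\<close>, one of \<open>exp (s (Z - r))\<close> and
  \<open>exp (s (- Z - r))\<close> is at least \<open>1\<close>.\<close>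

lemma prob_two_sided_tail_le:
  fixes Z :: "'a \<Rightarrow> real"
  assumes [measurable]: "random_variable borel Z" "F \<in> sets borel"
    and int: "\<And>c. integrable M (\<lambda>\<omega>. exp (c * Z \<omega>))"
    and F: "\<And>x. x \<in> F \<Longrightarrow> r \<le> \<bar>x\<bar>" and "s \<ge> 0"
  shows "prob {\<omega>\<in>space M. Z \<omega> \<in> F} \<le>
    exp (-(s * r)) * (expectation (\<lambda>\<omega>. exp (s * Z \<omega>)) + expectation (\<lambda>\<omega>. exp (- s * Z \<omega>)))"
proof -
  let ?A = "{\<omega>\<in>space M. Z \<omega> \<in> F}"
  have A: "?A \<in> events" by measurable
  have "prob ?A = expectation (indicator ?A)" using A by simp
  also have "\<dots> \<le> expectation (\<lambda>\<omega>. exp (-(s*r)) * (exp (s * Z \<omega>) + exp (- s * Z \<omega>)))"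
  proof (rule integral_mono)
    show "integrable M (indicator ?A :: 'a \<Rightarrow> real)" using A by (simp add: integrable_indicator_iff emeasure_eq_measure)
    show "integrable M (\<lambda>\<omega>. exp (-(s*r)) * (exp (s * Z \<omega>) + exp (- s * Z \<omega>)))"
      by (intro integrable_mult_right Bochner_Integration.integrable_add int)
    fix \<omega> assume \<omega>: "\<omega> \<in> space M"
    show "indicator ?A \<omega> \<le> exp (-(s*r)) * (exp (s * Z \<omega>) + exp (- s * Z \<omega>))"
    proof (cases "Z \<omega> \<in> F")
      case True
      then have "Z \<omega> \<ge> r \<or> - Z \<omega> \<ge> r" using F[of "Z \<omega>"] by linarith
      then have "exp (-(s*r)) * exp (s * Z \<omega>) \<ge> 1 \<or> exp (-(s*r)) * exp (- s * Z \<omega>) \<ge> 1"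
        using \<open>s \<ge> 0\<close> mult_left_mono[of r "Z \<omega>" s] mult_left_mono[of r "- Z \<omega>" s]
        by (auto simp: exp_add[symmetric])
      then have "1 \<le> exp (-(s*r)) * (exp (s * Z \<omega>) + exp (- s * Z \<omega>))"
        by (auto simp: distrib_left add_increasing add_increasing2)
      then show ?thesis by (simp add: indicator_def)
    qed simp
  qed
  also have "\<dots> = exp (-(s * r)) * (expectation (\<lambda>\<omega>. exp (s * Z \<omega>)) + expectation (\<lambda>\<omega>. exp (- s * Z \<omega>)))"
    by (simp only: integral_mult_right_zero Bochner_Integration.integral_add[OF int int])
  finally show ?thesis .
qed

text \<open>This replaces the change of measure with density proportional to \<open>exp (t Z)\<close>. Under that measure,
  the mass outside the \<open>\<epsilon>\<close>-ball around \<open>x\<close> is bounded by the exponential Markov inequality with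
  parameter \<open>s\<close> on either side, which gives the last two terms; inside the ball, \<open>exp (t Z)\<close> is almost
  constant. Read backwards, the inequality is a lower bound for the probability of the ball.\<close>

lemma mgf_le_tilted_ball:
  fixes Z :: "'a \<Rightarrow> real"
  assumes [measurable]: "random_variable borel Z"
    and int: "\<And>c. integrable M (\<lambda>\<omega>. exp (c * Z \<omega>))" and "s \<ge> 0"
  shows "expectation (\<lambda>\<omega>. exp (t * Z \<omega>)) \<le>
     exp (t * x + \<bar>t\<bar> * \<epsilon>) * prob {\<omega>\<in>space M. \<bar>Z \<omega> - x\<bar> < \<epsilon>}
     + exp (- s * (x + \<epsilon>)) * expectation (\<lambda>\<omega>. exp ((t + s) * Z \<omega>))
     + exp (s * (x - \<epsilon>)) * expectation (\<lambda>\<omega>. exp ((t - s) * Z \<omega>))"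
proof -
  let ?B = "{\<omega>\<in>space M. \<bar>Z \<omega> - x\<bar> < \<epsilon>}"
  have B: "?B \<in> events" by measurable
  have iB: "integrable M (indicator ?B :: 'a \<Rightarrow> real)" using B by (simp add: integrable_indicator_iff emeasure_eq_measure)
  have "expectation (\<lambda>\<omega>. exp (t * Z \<omega>)) \<le> expectation (\<lambda>\<omega>. 
     exp (t * x + \<bar>t\<bar> * \<epsilon>) * indicator ?B \<omega> + exp (- s * (x + \<epsilon>)) * exp ((t + s) * Z \<omega>)
     + exp (s * (x - \<epsilon>)) * exp ((t - s) * Z \<omega>))"
  proof (rule integral_mono)
    fix \<omega> assume \<omega>: "\<omega> \<in> space M"
    consider "\<bar>Z \<omega> - x\<bar> < \<epsilon>" | "Z \<omega> \<ge> x + \<epsilon>" | "Z \<omega> \<le> x - \<epsilon>" by linarith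
    then show "exp (t * Z \<omega>) \<le> exp (t * x + \<bar>t\<bar> * \<epsilon>) * indicator ?B \<omega> + exp (- s * (x + \<epsilon>)) * exp ((t + s) * Z \<omega>)
      + exp (s * (x - \<epsilon>)) * exp ((t - s) * Z \<omega>)"
    proof cases
      case 1
      have "t * (Z \<omega> - x) \<le> \<bar>t\<bar> * \<epsilon>"
        using mult_left_mono[of "\<bar>Z \<omega> - x\<bar>" \<epsilon> "\<bar>t\<bar>"] 1 abs_ge_self[of "t * (Z \<omega> - x)"]
        by (simp add: abs_mult)
      then have "exp (t * Z \<omega>) \<le> exp (t * x + \<bar>t\<bar> * \<epsilon>)" by (simp add: algebra_simps)
      also have "\<dots> = exp (t * x + \<bar>t\<bar> * \<epsilon>) * indicator ?B \<omega>" using 1 \<omega> by simp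
      finally show ?thesis by (simp add: add_increasing2)
    next
      case 2
      have "t * Z \<omega> \<le> - s * (x + \<epsilon>) + (t + s) * Z \<omega>"
        using mult_left_mono[OF 2 \<open>s \<ge> 0\<close>] by (simp add: algebra_simps)
      then have "exp (t * Z \<omega>) \<le> exp (- s * (x + \<epsilon>)) * exp ((t + s) * Z \<omega>)" by (simp add: exp_add[symmetric])
      then show ?thesis by (rule order_trans) (simp add: add_increasing add_increasing2)
    next
      case 3
      have "t * Z \<omega> \<le> s * (x - \<epsilon>) + (t - s) * Z \<omega>"
        using mult_left_mono[OF 3 \<open>s \<ge> 0\<close>] by (simp add: algebra_simps)
      then have "exp (t * Z \<omega>) \<le> exp (s * (x - \<epsilon>)) * exp ((t - s) * Z \<omega>)" by (simp add: exp_add[symmetric])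
      then show ?thesis by (rule order_trans) (simp add: add_increasing add_increasing2)
    qed
  next
    show "integrable M (\<lambda>\<omega>. exp (t * Z \<omega>))" by (rule int)
    show "integrable M (\<lambda>\<omega>. exp (t * x + \<bar>t\<bar> * \<epsilon>) * indicator ?B \<omega> + exp (- s * (x + \<epsilon>)) * exp ((t + s) * Z \<omega>)
     + exp (s * (x - \<epsilon>)) * exp ((t - s) * Z \<omega>))"
      by (intro Bochner_Integration.integrable_add integrable_mult_right int iB)
  qed
  also have "\<dots> = exp (t * x + \<bar>t\<bar> * \<epsilon>) * expectation (indicator ?B)
     + exp (- s * (x + \<epsilon>)) * expectation (\<lambda>\<omega>. exp ((t + s) * Z \<omega>))
     + exp (s * (x - \<epsilon>)) * expectation (\<lambda>\<omega>. exp ((t - s) * Z \<omega>))"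
    by (subst Bochner_Integration.integral_add, (intro Bochner_Integration.integrable_add integrable_mult_right int iB)+)+
       (simp only: integral_mult_right_zero)
  also have "expectation (indicator ?B) = prob ?B" using B by simp
  finally show ?thesis .
qed

lemma mgf_pos:
  assumes "integrable M (\<lambda>\<omega>. exp (c * Z \<omega> :: real))"
  shows "expectation (\<lambda>\<omega>. exp (c * Z \<omega>)) > 0"
  using assms integral_less_AE_space[of "\<lambda>_. 0" "\<lambda>\<omega>. exp (c * Z \<omega>)"] by (simp add: emeasure_space_1)

end

lemma exp_neg_speed_tendsto_0:
  fixes b u :: "nat \<Rightarrow> real"
  assumes "filterlim b at_top sequentially" "u \<longlonglongrightarrow> - c" "c > 0"
  shows "(\<lambda>n. exp (b n * u n)) \<longlonglongrightarrow> 0"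
proof -
  have "filterlim (\<lambda>n. u n * b n) at_bot sequentially"
    using assms by (intro filterlim_tendsto_neg_mult_at_bot[OF assms(2)]) auto
  then show ?thesis by (intro filterlim_compose[OF exp_at_bot]) (simp add: mult.commute)
qed

text \<open>The limit \<open>\<theta> l\<^sup>2 / 2\<close> is the logarithmic moment generating function of a centred Gaussian variable
  with variance \<open>\<theta>\<close>; its convex conjugate is \<^const>\<open>rate_fun\<close>.\<close>

locale gaussian_log_mgf = prob_space M for M :: "'a measure" +
  fixes Z :: "nat \<Rightarrow> 'a \<Rightarrow> real" and b :: "nat \<Rightarrow> real" and \<theta> :: real
  assumes Z_meas[measurable]: "\<And>n. random_variable borel (Z n)"
    and exp_int: "\<And>n c. integrable M (\<lambda>\<omega>. exp (c * Z n \<omega>))"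
    and speed: "filterlim b at_top sequentially"
    and theta_pos: "\<theta> > 0"
    and log_mgf: "\<And>l. (\<lambda>n. ln (expectation (\<lambda>\<omega>. exp (l * b n * Z n \<omega>))) / b n) \<longlonglongrightarrow> \<theta> * l\<^sup>2 / 2"
begin

abbreviation \<Lambda> :: "nat \<Rightarrow> real \<Rightarrow> real" where
  "\<Lambda> n l \<equiv> ln (expectation (\<lambda>\<omega>. exp (l * b n * Z n \<omega>))) / b n"

lemma mgf_eq: "b n > 0 \<Longrightarrow> expectation (\<lambda>\<omega>. exp (l * b n * Z n \<omega>)) = exp (b n * \<Lambda> n l)"
  using mgf_pos[OF exp_int, of "l * b n" n] by simp

lemma speed_pos: "\<forall>\<^sub>F n in sequentially. b n > 0"
  using speed by (simp add: filterlim_at_top_dense)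

lemma const_over_speed: "(\<lambda>n. c / b n) \<longlonglongrightarrow> 0"
  by (intro tendsto_divide_0[OF tendsto_const] filterlim_mono[OF speed at_top_le_at_infinity order_refl])

text \<open>The exponential Markov inequality with the parameter \<open>r / \<theta>\<close>, which maximises \<open>l r - \<theta> l\<^sup>2 / 2\<close>.\<close>

lemma upper_bound_outside_interval:
  assumes [measurable]: "F \<in> sets borel" and r: "r \<ge> 0" and F: "\<And>x. x \<in> F \<Longrightarrow> r \<le> \<bar>x\<bar>"
  shows "limsup (\<lambda>n. ereal (1 / b n) * elog (prob {\<omega>\<in>space M. Z n \<omega> \<in> F})) \<le> ereal (- (r\<^sup>2 / (2 * \<theta>)))"
proof -
  define l where "l = r / \<theta>"
  have l: "l \<ge> 0" using r theta_pos by (simp add: l_def)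
  define v where "v n = ln 2 / b n + max (\<Lambda> n l) (\<Lambda> n (- l)) - l * r" for n
  have "v \<longlonglongrightarrow> 0 + max (\<theta> * l\<^sup>2 / 2) (\<theta> * (- l)\<^sup>2 / 2) - l * r"
    unfolding v_def by (intro tendsto_intros const_over_speed log_mgf)
  also have "0 + max (\<theta> * l\<^sup>2 / 2) (\<theta> * (- l)\<^sup>2 / 2) - l * r = - (r\<^sup>2 / (2 * \<theta>))"
    using theta_pos by (simp add: l_def power2_eq_square field_simps)
  finally have lim: "(\<lambda>n. ereal (v n)) \<longlonglongrightarrow> ereal (- (r\<^sup>2 / (2 * \<theta>)))" by simp
  have "\<forall>\<^sub>F n in sequentially. ereal (1 / b n) * elog (prob {\<omega>\<in>space M. Z n \<omega> \<in> F}) \<le> ereal (v n)"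
    using speed_pos
  proof eventually_elim
    case (elim n)
    have "prob {\<omega>\<in>space M. Z n \<omega> \<in> F} \<le> exp (-(l * b n * r)) *
        (expectation (\<lambda>\<omega>. exp (l * b n * Z n \<omega>)) + expectation (\<lambda>\<omega>. exp (- (l * b n) * Z n \<omega>)))"
      using elim l by (intro prob_two_sided_tail_le exp_int F) auto
    also have "\<dots> = exp (-(l * b n * r)) * (exp (b n * \<Lambda> n l) + exp (b n * \<Lambda> n (- l)))"
      using mgf_eq[OF elim, of l] mgf_eq[OF elim, of "- l"] by simp
    also have "\<dots> \<le> exp (-(l * b n * r)) * (2 * exp (b n * max (\<Lambda> n l) (\<Lambda> n (- l))))"
    proof -
      have "exp (b n * \<Lambda> n l) \<le> exp (b n * max (\<Lambda> n l) (\<Lambda> n (- l)))"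
        "exp (b n * \<Lambda> n (-l)) \<le> exp (b n * max (\<Lambda> n l) (\<Lambda> n (- l)))"
        unfolding exp_le_cancel_iff using elim by (auto intro!: mult_left_mono simp del: times_divide_eq_right)
      then have "exp (b n * \<Lambda> n l) + exp (b n * \<Lambda> n (- l)) \<le> 2 * exp (b n * max (\<Lambda> n l) (\<Lambda> n (- l)))"
        by linarith
      then show ?thesis by (intro mult_left_mono) simp_all
    qed
    also have "\<dots> = exp (b n * v n)"
      using elim by (simp add: v_def exp_add exp_diff exp_minus algebra_simps del: times_divide_eq_right)
        (simp add: field_simps)
    finally show ?case using elim by (intro scaled_elog_le) auto
  qed
  then have "limsup (\<lambda>n. ereal (1 / b n) * elog (prob {\<omega>\<in>space M. Z n \<omega> \<in> F})) \<le> limsup (\<lambda>n. ereal (v n))"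
    by (rule Limsup_mono)
  also have "\<dots> = ereal (- (r\<^sup>2 / (2 * \<theta>)))" using lim by (intro lim_imp_Limsup) auto
  finally show ?thesis .
qed

text \<open>The rate function increases with \<open>\<bar>x\<bar>\<close>, so a set on which it exceeds \<open>q\<close> lies outside the interval of radius
  \<open>\<surd>(2 \<theta> q)\<close>. Letting \<open>q\<close> increase to the infimum also covers an infinite infimum, that is, the empty set.\<close>

lemma ldp_upper:
  assumes [measurable]: "F \<in> sets borel"
  shows "limsup (\<lambda>n. ereal (1 / b n) * elog (prob {\<omega>\<in>space M. Z n \<omega> \<in> F})) \<le> - (INF x\<in>F. ereal (rate_fun \<theta> x))"
    (is "?L \<le> - ?I")
proof -
  have "?I \<le> - ?L"
  proof (rule dense_le)
    fix y assume y: "y < ?I"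
    show "y \<le> - ?L"
    proof (cases "y \<le> 0")
      case True
      have "?L \<le> 0" using upper_bound_outside_interval[of F 0] by (simp add: zero_ereal_def)
      then have "0 \<le> - ?L" by simp
      then show ?thesis using True by (rule order_trans[rotated])
    next
      case False
      moreover have "y \<noteq> \<infinity>" using y by auto
      ultimately obtain q where q: "y = ereal q" "q > 0" by (cases y) auto
      define r where "r = sqrt (2 * \<theta> * q)"
      have r2: "r\<^sup>2 = 2 * \<theta> * q" "r \<ge> 0" using q theta_pos by (auto simp: r_def)
      have "r \<le> \<bar>x\<bar>" if "x \<in> F" for x
      proof -
        have "y < ereal (rate_fun \<theta> x)" using y that by (rule less_INF_D)
        then have "r\<^sup>2 \<le> \<bar>x\<bar>\<^sup>2" using theta_pos by (simp add: q r2 rate_fun_def field_simps)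
        then show ?thesis by (rule power2_le_imp_le) simp
      qed
      then have "?L \<le> ereal (- (r\<^sup>2 / (2 * \<theta>)))" using r2 by (intro upper_bound_outside_interval) auto
      also have "\<dots> = - y" using theta_pos by (simp add: r2 q)
      finally show ?thesis by (subst ereal_minus_le_minus[symmetric]) simp
    qed
  qed
  then show ?thesis by (subst ereal_minus_le_minus[symmetric]) simp
qed

text \<open>The tilt \<open>l = x / \<theta>\<close> moves the mean to \<open>x\<close>. The correction \<open>s = \<epsilon> / \<theta>\<close> then makes the tilted mass
  outside the ball decay like \<open>exp (- b \<epsilon>\<^sup>2 / (2 \<theta>))\<close>, so that at least half of the tilted mass stays in it.\<close>

lemma lower_bound_ball:
  assumes [measurable]: "G \<in> sets borel" and \<epsilon>: "\<epsilon> > 0" and G: "\<And>y. \<bar>y - x\<bar> < \<epsilon> \<Longrightarrow> y \<in> G"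
  shows "ereal (- (x\<^sup>2 / (2 * \<theta>)) - \<bar>x / \<theta>\<bar> * \<epsilon>) \<le> liminf (\<lambda>n. ereal (1 / b n) * elog (prob {\<omega>\<in>space M. Z n \<omega> \<in> G}))"
proof -
  define l where "l = x / \<theta>"
  define s where "s = \<epsilon> / \<theta>"
  have s: "s > 0" using \<epsilon> theta_pos by (simp add: s_def)
  define v where "v n = \<Lambda> n l - ln 2 / b n - (l * x + \<bar>l\<bar> * \<epsilon>)" for n
  define u1 where "u1 n = \<Lambda> n (l + s) - \<Lambda> n l - s * (x + \<epsilon>)" for n
  define u2 where "u2 n = \<Lambda> n (l - s) - \<Lambda> n l + s * (x - \<epsilon>)" for n
  have lx: "x = l * \<theta>" and se: "\<epsilon> = s * \<theta>" using theta_pos by (auto simp: l_def s_def)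
  have "u1 \<longlonglongrightarrow> \<theta> * (l + s)\<^sup>2 / 2 - \<theta> * l\<^sup>2 / 2 - s * (x + \<epsilon>)"
    unfolding u1_def by (intro tendsto_intros log_mgf)
  also have "\<theta> * (l + s)\<^sup>2 / 2 - \<theta> * l\<^sup>2 / 2 - s * (x + \<epsilon>) = - (\<theta> * s\<^sup>2 / 2)"
    unfolding lx se by (simp add: power2_eq_square field_simps)
  finally have "(\<lambda>n. exp (b n * u1 n)) \<longlonglongrightarrow> 0"
    by (rule exp_neg_speed_tendsto_0[OF speed]) (use theta_pos s in simp)
  then have e1: "\<forall>\<^sub>F n in sequentially. exp (b n * u1 n) < 1/4" by (rule order_tendstoD) simp
  have "u2 \<longlonglongrightarrow> \<theta> * (l - s)\<^sup>2 / 2 - \<theta> * l\<^sup>2 / 2 + s * (x - \<epsilon>)"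
    unfolding u2_def by (intro tendsto_intros log_mgf)
  also have "\<theta> * (l - s)\<^sup>2 / 2 - \<theta> * l\<^sup>2 / 2 + s * (x - \<epsilon>) = - (\<theta> * s\<^sup>2 / 2)"
    unfolding lx se by (simp add: power2_eq_square field_simps)
  finally have "(\<lambda>n. exp (b n * u2 n)) \<longlonglongrightarrow> 0"
    by (rule exp_neg_speed_tendsto_0[OF speed]) (use theta_pos s in simp)
  then have e2: "\<forall>\<^sub>F n in sequentially. exp (b n * u2 n) < 1/4" by (rule order_tendstoD) simp
  have "v \<longlonglongrightarrow> \<theta> * l\<^sup>2 / 2 - 0 - (l * x + \<bar>l\<bar> * \<epsilon>)"
    unfolding v_def by (intro tendsto_intros const_over_speed log_mgf)
  also have "\<theta> * l\<^sup>2 / 2 - 0 - (l * x + \<bar>l\<bar> * \<epsilon>) = - (x\<^sup>2 / (2 * \<theta>)) - \<bar>x / \<theta>\<bar> * \<epsilon>"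
    using theta_pos by (simp add: l_def power2_eq_square field_simps)
  finally have lim: "(\<lambda>n. ereal (v n)) \<longlonglongrightarrow> ereal (- (x\<^sup>2 / (2 * \<theta>)) - \<bar>x / \<theta>\<bar> * \<epsilon>)" by simp
  have "\<forall>\<^sub>F n in sequentially. ereal (v n) \<le> ereal (1 / b n) * elog (prob {\<omega>\<in>space M. Z n \<omega> \<in> G})"
    using speed_pos e1 e2
  proof eventually_elim
    case (elim n)
    let ?p = "prob {\<omega>\<in>space M. \<bar>Z n \<omega> - x\<bar> < \<epsilon>}"
    have "expectation (\<lambda>\<omega>. exp (l * b n * Z n \<omega>)) \<le>
       exp (l * b n * x + \<bar>l * b n\<bar> * \<epsilon>) * ?p
       + exp (- (s * b n) * (x + \<epsilon>)) * expectation (\<lambda>\<omega>. exp ((l * b n + s * b n) * Z n \<omega>))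
       + exp (s * b n * (x - \<epsilon>)) * expectation (\<lambda>\<omega>. exp ((l * b n - s * b n) * Z n \<omega>))"
      using elim s by (intro mgf_le_tilted_ball exp_int) auto
    then have "exp (b n * \<Lambda> n l) \<le> exp (b n * (l * x + \<bar>l\<bar> * \<epsilon>)) * ?p
       + exp (- (s * b n) * (x + \<epsilon>)) * exp (b n * \<Lambda> n (l + s))
       + exp (s * b n * (x - \<epsilon>)) * exp (b n * \<Lambda> n (l - s))"
      unfolding mgf_eq[OF elim(1), symmetric] using elim(1) by (simp add: algebra_simps abs_mult)
    also have "exp (- (s * b n) * (x + \<epsilon>)) * exp (b n * \<Lambda> n (l + s)) = exp (b n * u1 n) * exp (b n * \<Lambda> n l)"
      unfolding exp_add[symmetric] u1_def by (simp add: algebra_simps del: times_divide_eq_right)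
    also have "exp (s * b n * (x - \<epsilon>)) * exp (b n * \<Lambda> n (l - s)) = exp (b n * u2 n) * exp (b n * \<Lambda> n l)"
      unfolding exp_add[symmetric] u2_def by (simp add: algebra_simps del: times_divide_eq_right)
    finally have "exp (b n * \<Lambda> n l) \<le> exp (b n * (l * x + \<bar>l\<bar> * \<epsilon>)) * ?p
       + exp (b n * u1 n) * exp (b n * \<Lambda> n l) + exp (b n * u2 n) * exp (b n * \<Lambda> n l)" .
    moreover have "exp (b n * u1 n) * exp (b n * \<Lambda> n l) \<le> 1/4 * exp (b n * \<Lambda> n l)"
      "exp (b n * u2 n) * exp (b n * \<Lambda> n l) \<le> 1/4 * exp (b n * \<Lambda> n l)"
      using elim by (intro mult_right_mono; simp)+
    ultimately have "exp (b n * \<Lambda> n l) / 2 \<le> exp (b n * (l * x + \<bar>l\<bar> * \<epsilon>)) * ?p" by linarith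
    moreover have "exp (b n * v n) = exp (b n * \<Lambda> n l) / 2 / exp (b n * (l * x + \<bar>l\<bar> * \<epsilon>))"
      using elim(1) by (simp add: v_def exp_diff right_diff_distrib del: times_divide_eq_right)
         (simp add: exp_diff)
    ultimately have "exp (b n * v n) \<le> ?p" by (simp add: divide_le_eq mult.commute)
    also have "?p \<le> prob {\<omega>\<in>space M. Z n \<omega> \<in> G}"
      using G by (intro finite_measure_mono) auto
    finally show ?case using elim by (intro scaled_elog_ge) auto
  qed
  then have "liminf (\<lambda>n. ereal (v n)) \<le> liminf (\<lambda>n. ereal (1 / b n) * elog (prob {\<omega>\<in>space M. Z n \<omega> \<in> G}))"
    by (rule Liminf_mono)
  moreover have "liminf (\<lambda>n. ereal (v n)) = ereal (- (x\<^sup>2 / (2 * \<theta>)) - \<bar>x / \<theta>\<bar> * \<epsilon>)"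
    using lim by (intro lim_imp_Liminf) auto
  ultimately show ?thesis by simp
qed

lemma ldp_lower:
  assumes "open G"
  shows "- (INF x\<in>G. ereal (rate_fun \<theta> x)) \<le> liminf (\<lambda>n. ereal (1 / b n) * elog (prob {\<omega>\<in>space M. Z n \<omega> \<in> G}))"
    (is "_ \<le> ?L")
proof -
  have G_meas: "G \<in> sets borel" using assms by simp
  have "- ?L \<le> ereal (rate_fun \<theta> x)" if "x \<in> G" for x
  proof -
    obtain e where e: "e > 0" "\<And>y. \<bar>y - x\<bar> < e \<Longrightarrow> y \<in> G"
      using assms \<open>x \<in> G\<close> by (force simp: open_dist dist_real_def)
    have "((\<lambda>\<epsilon>. ereal (- (x\<^sup>2 / (2 * \<theta>)) - \<bar>x / \<theta>\<bar> * \<epsilon>)) \<longlongrightarrow> ereal (- (x\<^sup>2 / (2 * \<theta>)) - \<bar>x / \<theta>\<bar> * 0)) (at_right 0)"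
      by (intro tendsto_intros)
    moreover have "\<forall>\<^sub>F \<epsilon> in at_right 0. ereal (- (x\<^sup>2 / (2 * \<theta>)) - \<bar>x / \<theta>\<bar> * \<epsilon>) \<le> ?L"
      using eventually_at_right_real[OF e(1)]
    proof eventually_elim
      case (elim \<epsilon>)
      then show ?case using e by (intro lower_bound_ball G_meas) auto
    qed
    ultimately have "ereal (- (x\<^sup>2 / (2 * \<theta>))) \<le> ?L"
      by (intro tendsto_upperbound[of _ _ "at_right (0::real)"]) auto
    then show ?thesis by (simp add: rate_fun_def ereal_uminus_le_reorder)
  qed
  then have "- ?L \<le> (INF x\<in>G. ereal (rate_fun \<theta> x))" by (intro INF_greatest)
  then show ?thesis by (simp add: ereal_uminus_le_reorder)
qed

end

section \<open>Expectations under the rows of a stochastic matrix\<close>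

lemma bounded_integrable_pmf:
  fixes g :: "'a \<Rightarrow> real"
  assumes "\<And>x. \<bar>g x\<bar> \<le> B"
  shows "integrable (measure_pmf p) g"
  by (rule measure_pmf.integrable_const_bound[where B=B]) (use assms in auto)

text \<open>The link between the unordered sums that define matrix norms and the integral of bounded functions.\<close>

lemma has_sum_pmf_expectation:
  fixes g :: "'a \<Rightarrow> real"
  assumes g: "\<And>x. \<bar>g x\<bar> \<le> B"
  shows "((\<lambda>x. pmf p x * g x) has_sum measure_pmf.expectation p g) UNIV"
proof -
  have abs: "Infinite_Set_Sum.abs_summable_on (\<lambda>x. pmf p x * g x) UNIV"
  proof (rule abs_summable_on_comparison_test')
    show "Infinite_Set_Sum.abs_summable_on (\<lambda>x. B * pmf p x) UNIV"
      by (intro abs_summable_on_cmult_right pmf_abs_summable)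
    show "norm (pmf p x * g x) \<le> B * pmf p x" for x
      using mult_left_mono[OF g[of x], of "pmf p x"] by (simp add: abs_mult mult.commute)
  qed
  then have "(\<lambda>x. pmf p x * g x) summable_on UNIV"
    by (rule abs_summable_summable[OF abs_summable_equivalent[THEN iffD2]])
  then show ?thesis
    unfolding pmf_expectation_eq_infsetsum infsetsum_infsum[OF abs] by (rule has_sum_infsum)
qed

lemma has_sum_pmf: "(pmf p has_sum 1) UNIV"
  using has_sum_pmf_expectation[of "\<lambda>_. 1" 1 p] by simp

lemma pmf_summable_on: "pmf p summable_on A"
  using has_sum_pmf[of p] summable_on_subset_banach[of "pmf p" UNIV A] by (auto simp: summable_on_def)

lemma summable_on_abs_pmf_diff: "(\<lambda>x. \<bar>pmf p x - pmf q x\<bar>) summable_on A"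
proof (rule summable_on_comparison_test)
  show "(\<lambda>x. pmf p x + pmf q x) summable_on A" by (intro summable_on_add pmf_summable_on)
  show "\<bar>pmf p x - pmf q x\<bar> \<le> pmf p x + pmf q x" for x
    using pmf_nonneg[of p x] pmf_nonneg[of q x] by linarith
qed simp

lemma summable_on_pos_pmf_diff: "(\<lambda>x. max 0 (pmf p x - pmf q x)) summable_on A"
  by (rule summable_on_comparison_test[OF pmf_summable_on[of p]]) auto

lemma pmf_expectation_diff_mono:
  fixes g h :: "'a \<Rightarrow> real"
  assumes "\<And>x. \<bar>g x\<bar> \<le> B" and h: "h summable_on UNIV"
    and le: "\<And>x. (pmf p x - pmf q x) * g x \<le> c * h x"
  shows "measure_pmf.expectation p g - measure_pmf.expectation q g \<le> c * (\<Sum>\<^sub>\<infinity>x. h x)"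
proof (rule has_sum_mono)
  show "((\<lambda>x. pmf p x * g x + - (pmf q x * g x)) has_sum
      (measure_pmf.expectation p g - measure_pmf.expectation q g)) UNIV"
    using has_sum_add[OF has_sum_pmf_expectation has_sum_uminusI[OF has_sum_pmf_expectation], of g B g B p q]
      assms(1) by simp
  show "((\<lambda>x. c * h x) has_sum c * (\<Sum>\<^sub>\<infinity>x. h x)) UNIV"
    using h by (intro has_sum_cmult_right has_sum_infsum)
qed (use le in \<open>simp add: left_diff_distrib\<close>)

lemma pmf_expectation_diff_le:
  fixes g :: "'a \<Rightarrow> real"
  assumes g: "\<And>x. \<bar>g x\<bar> \<le> B"
  shows "\<bar>measure_pmf.expectation p g - measure_pmf.expectation q g\<bar> \<le> B * (\<Sum>\<^sub>\<infinity>x. \<bar>pmf p x - pmf q x\<bar>)"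
proof -
  have le: "(pmf p x - pmf q x) * g x \<le> B * \<bar>pmf p x - pmf q x\<bar>" for p q :: "'a pmf" and x
    using mult_left_mono[OF g[of x], of "\<bar>pmf p x - pmf q x\<bar>"] abs_ge_self[of "(pmf p x - pmf q x) * g x"]
    by (simp add: abs_mult mult.commute)
  show ?thesis
    using pmf_expectation_diff_mono[OF g summable_on_abs_pmf_diff le, of p q]
      pmf_expectation_diff_mono[OF g summable_on_abs_pmf_diff le, of q p]
    by (simp add: abs_minus_commute abs_le_iff)
qed

text \<open>Both laws have mass \<open>1\<close>, so \<open>g\<close> may be replaced by \<open>g + B\<close>, which has values between \<open>0\<close> and \<open>2 B\<close>; then only
  the positive part of the difference of the weights contributes to the upper bound.\<close>

lemma pmf_expectation_diff_le_pos_part: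
  fixes g :: "'a \<Rightarrow> real"
  assumes g: "\<And>x. \<bar>g x\<bar> \<le> B"
  shows "measure_pmf.expectation p g - measure_pmf.expectation q g \<le> 2 * B * (\<Sum>\<^sub>\<infinity>x. max 0 (pmf p x - pmf q x))"
proof -
  have gB: "\<bar>g x + B\<bar> \<le> 2 * B" for x using g[of x] by linarith
  have int: "integrable (measure_pmf r) g" for r using g by (rule bounded_integrable_pmf)
  have "measure_pmf.expectation p g - measure_pmf.expectation q g
      = measure_pmf.expectation p (\<lambda>x. g x + B) - measure_pmf.expectation q (\<lambda>x. g x + B)"
    using int by simp
  also have "\<dots> \<le> 2 * B * (\<Sum>\<^sub>\<infinity>x. max 0 (pmf p x - pmf q x))"
  proof (rule pmf_expectation_diff_mono[OF gB summable_on_pos_pmf_diff])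
    fix x
    have "(pmf p x - pmf q x) * (g x + B) \<le> max 0 (pmf p x - pmf q x) * (g x + B)"
      using g[of x] by (intro mult_right_mono) auto
    also have "\<dots> \<le> max 0 (pmf p x - pmf q x) * (2 * B)"
      using g[of x] by (intro mult_left_mono) auto
    finally show "(pmf p x - pmf q x) * (g x + B) \<le> 2 * B * max 0 (pmf p x - pmf q x)" 
      by (simp add: mult.commute)
  qed
  finally show ?thesis .
qed

text \<open>The law on all natural numbers that gives no weight to \<open>0\<close>, which is not a state.\<close>

definition row_pmf :: "mat \<Rightarrow> nat \<Rightarrow> nat pmf" where
  "row_pmf A i = embed_pmf (\<lambda>j. if j \<in> states then A i j else 0)"

lemma pmf_row_pmf:
  assumes "stochastic_mat states A" "i \<in> states"
  shows "pmf (row_pmf A i) j = (if j \<in> states then A i j else 0)"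
  unfolding row_pmf_def
proof (rule pmf_embed_pmf)
  let ?g = "\<lambda>j. if j \<in> states then A i j else 0"
  have nonneg: "\<And>j. j \<in> states \<Longrightarrow> 0 \<le> A i j" and sum: "(A i has_sum 1) states"
    using assms by (auto simp: stochastic_mat_def)
  show "0 \<le> ?g j" for j using nonneg by auto
  have "(?g has_sum 1) UNIV" using sum by (subst has_sum_cong_neutral[where T=states and g="A i"]) auto
  then have "?g sums 1" by (rule has_sum_imp_sums)
  then show "(\<integral>\<^sup>+j. ennreal (?g j) \<partial>count_space UNIV) = 1"
    using nonneg by (subst nn_integral_count_space_nat, subst suminf_ennreal2) (auto simp: sums_iff)
qed

lemma infsum_rows_eq_infsum_pmfs:
  fixes h :: "real \<Rightarrow> real \<Rightarrow> real"
  assumes "h 0 0 = 0" "stochastic_mat states A" "stochastic_mat states B" "i \<in> states" "k \<in> states"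
  shows "(\<Sum>\<^sub>\<infinity>j\<in>states. h (A i j) (B k j)) = (\<Sum>\<^sub>\<infinity>j. h (pmf (row_pmf A i) j) (pmf (row_pmf B k) j))"
  using assms by (intro infsum_cong_neutral) (auto simp: pmf_row_pmf)

text \<open>The absolute row sums of the difference are at most \<open>2\<close>; so the real-valued supremum in
  \<^const>\<open>mat_norm\<close> is taken over a bounded set and dominates each of them.\<close>

lemma row_dist_le_mat_norm:
  assumes "stochastic_mat states A" "stochastic_mat states B" "i \<in> states"
  shows "(\<Sum>\<^sub>\<infinity>j. \<bar>pmf (row_pmf A i) j - pmf (row_pmf B i) j\<bar>) \<le> mat_norm states (mat_diff A B)"
    and "mat_norm states (mat_diff A B) \<le> 2"
proof -
  let ?d = "\<lambda>i. \<Sum>\<^sub>\<infinity>j. \<bar>pmf (row_pmf A i) j - pmf (row_pmf B i) j\<bar>"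
  have d2: "?d i \<le> 2" for i
  proof -
    have "?d i \<le> (\<Sum>\<^sub>\<infinity>j. pmf (row_pmf A i) j + pmf (row_pmf B i) j)"
      by (intro infsum_mono summable_on_abs_pmf_diff summable_on_add pmf_summable_on)
         (metis abs_diff_triangle_ineq abs_of_nonneg abs_triangle_ineq4 pmf_nonneg)
    also have "\<dots> = 2" by (subst infsum_add) (auto simp: pmf_summable_on infsumI[OF has_sum_pmf])
    finally show ?thesis .
  qed
  have eq: "mat_norm states (mat_diff A B) = (SUP i\<in>states. ?d i)"
    unfolding mat_norm_def mat_diff_def using assms
    by (intro SUP_cong refl infsum_rows_eq_infsum_pmfs[where h="\<lambda>a b. \<bar>a - b\<bar>"]) auto
  show "?d i \<le> mat_norm states (mat_diff A B)"
    unfolding eq by (rule cSUP_upper[OF assms(3)]) (auto intro!: bdd_aboveI[of _ 2] d2)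
  show "mat_norm states (mat_diff A B) \<le> 2"
    unfolding eq by (rule cSUP_least) (use d2 in auto)
qed

lemma mat_norm_nonneg:
  assumes "stochastic_mat states A" "stochastic_mat states B"
  shows "0 \<le> mat_norm states (mat_diff A B)"
  using row_dist_le_mat_norm(1)[OF assms, of 1] infsum_nonneg[of UNIV "\<lambda>j. \<bar>pmf (row_pmf A 1) j - pmf (row_pmf B 1) j\<bar>"]
  by force

lemma row_pos_diff_le_ergodic_coeff:
  assumes "stochastic_mat states A" "i \<in> states" "k \<in> states"
  shows "(\<Sum>\<^sub>\<infinity>j. max 0 (pmf (row_pmf A i) j - pmf (row_pmf A k) j)) \<le> ergodic_coeff states A"
    and "ergodic_coeff states A \<le> 1"
proof -
  let ?d = "\<lambda>i k. \<Sum>\<^sub>\<infinity>j. max 0 (pmf (row_pmf A i) j - pmf (row_pmf A k) j)"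
  have d1: "?d i k \<le> 1" for i k
  proof -
    have "?d i k \<le> (\<Sum>\<^sub>\<infinity>j. pmf (row_pmf A i) j)"
      by (intro infsum_mono summable_on_pos_pmf_diff pmf_summable_on) auto
    then show ?thesis by (simp add: infsumI[OF has_sum_pmf])
  qed
  have eq: "ergodic_coeff states A = (SUP (i, k)\<in>states \<times> states. ?d i k)"
    unfolding ergodic_coeff_def using assms infsum_rows_eq_infsum_pmfs[where h="\<lambda>a b. max 0 (a - b)" and A=A and B=A]
    by (intro SUP_cong refl) (simp add: case_prod_beta mem_Times_iff)
  show "?d i k \<le> ergodic_coeff states A"
    unfolding eq using assms
    by (intro cSUP_upper2[of _ _ "(i, k)"]) (auto intro!: bdd_aboveI[of _ 1] d1)
  show "ergodic_coeff states A \<le> 1"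
    unfolding eq by (rule cSUP_least) (use d1 in auto)
qed

lemma ergodic_coeff_nonneg:
  assumes "stochastic_mat states A"
  shows "0 \<le> ergodic_coeff states A"
  using row_pos_diff_le_ergodic_coeff(1)[OF assms, of 1 1] by simp

lemma infsum_eq_row_expectation:
  assumes "stochastic_mat states A" "i \<in> states" "\<And>x. \<bar>g x\<bar> \<le> B"
  shows "(\<Sum>\<^sub>\<infinity>j\<in>states. g j * A i j) = measure_pmf.expectation (row_pmf A i) g"
proof -
  have "(\<Sum>\<^sub>\<infinity>j\<in>states. g j * A i j) = (\<Sum>\<^sub>\<infinity>j. pmf (row_pmf A i) j * g j)"
    using assms by (intro infsum_cong_neutral) (auto simp: pmf_row_pmf)
  then show ?thesis using infsumI[OF has_sum_pmf_expectation[OF assms(3)]] by simp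
qed

lemma row_expectation_near:
  fixes g :: "nat \<Rightarrow> real"
  assumes "stochastic_mat states A" "stochastic_mat states B" "i \<in> states" "\<And>x. \<bar>g x\<bar> \<le> C"
  shows "\<bar>measure_pmf.expectation (row_pmf A i) g - measure_pmf.expectation (row_pmf B i) g\<bar>
      \<le> C * mat_norm states (mat_diff A B)"
proof -
  have C: "C \<ge> 0" using assms(4)[of 0] by linarith
  show ?thesis
    using pmf_expectation_diff_le[where g=g, OF assms(4), where p="row_pmf A i" and q="row_pmf B i"]
       mult_left_mono[OF row_dist_le_mat_norm(1)[OF assms(1-3)] C] by linarith
qed

lemma row_expectation_oscillation:
  fixes g :: "nat \<Rightarrow> real"
  assumes "stochastic_mat states A" "i \<in> states" "k \<in> states" "\<And>x. \<bar>g x\<bar> \<le> C"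
  shows "\<bar>measure_pmf.expectation (row_pmf A i) g - measure_pmf.expectation (row_pmf A k) g\<bar>
      \<le> 2 * C * ergodic_coeff states A"
proof -
  have C: "C \<ge> 0" using assms(4)[of 0] by linarith
  have "measure_pmf.expectation (row_pmf A i) g - measure_pmf.expectation (row_pmf A k) g
      \<le> 2 * C * ergodic_coeff states A" if "i \<in> states" "k \<in> states" for i k
    using pmf_expectation_diff_le_pos_part[where g=g, OF assms(4), where p="row_pmf A i" and q="row_pmf A k"]
       mult_left_mono[OF row_pos_diff_le_ergodic_coeff(1)[OF assms(1) that], of "2 * C"] C by linarith
  from this[OF assms(2,3)] this[OF assms(3,2)] show ?thesis by linarith
qed

text \<open>An entry of a row is the expectation of an indicator: pass from row \<open>i\<close> of \<open>P\<close> to row \<open>i\<close> of \<open>Q\<close>, from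
  there to row \<open>k\<close> of \<open>Q\<close>, and back to \<open>P\<close>. With \<open>Q\<close> running through the transition matrices, this
  forces the rows of the limit matrix to agree.\<close>

lemma row_entry_diff_le:
  assumes Q: "stochastic_mat states Q" and P: "stochastic_mat states P" and ik: "i \<in> states" "k \<in> states"
    and j: "j \<in> states"
  shows "\<bar>P i j - P k j\<bar> \<le> 2 * mat_norm states (mat_diff Q P) + 2 * ergodic_coeff states Q"
proof -
  let ?g = "indicator {j} :: nat \<Rightarrow> real"
  have g: "\<bar>?g x\<bar> \<le> 1" for x by (auto simp: indicator_def)
  have E: "measure_pmf.expectation (row_pmf P l) ?g = P l j" if "l \<in> states" for l
    using P j that by (simp add: measure_pmf_single pmf_row_pmf)
  show ?thesis
    using row_expectation_near[where g="?g", OF Q P ik(1) g] row_expectation_near[where g="?g", OF Q P ik(2) g]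
      row_expectation_oscillation[where g="?g", OF Q ik g]
    unfolding E[OF ik(1)] E[OF ik(2)] by linarith
qed

section \<open>The Markov property for products of functions of the states\<close>

text \<open>The most recent state comes first, so that one step of the chain is a \<^const>\<open>Cons\<close>. Histories
  have a countable type, so that their laws are determined by the probabilities of single histories.\<close>

primrec history :: "(nat \<Rightarrow> 'a \<Rightarrow> nat) \<Rightarrow> nat \<Rightarrow> 'a \<Rightarrow> nat list" where
  "history X 0 \<omega> = [X 0 \<omega>]"
| "history X (Suc n) \<omega> = X (Suc n) \<omega> # history X n \<omega>"

lemma hd_history: "hd (history X n \<omega>) = X n \<omega>"
  by (cases n) auto

lemma history_nth: "k \<le> n \<Longrightarrow> history X n \<omega> ! (n - k) = X k \<omega>"
  by (induction n) (auto simp: le_Suc_eq Suc_diff_le)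

lemma history_eq_iff: "history X n \<omega> = history X n \<omega>' \<longleftrightarrow> (\<forall>k\<le>n. X k \<omega> = X k \<omega>')"
  by (induction n) (auto simp: le_Suc_eq)

locale nonhomogeneous_chain = prob_space M for M :: "'a measure" +
  fixes X :: "nat \<Rightarrow> 'a \<Rightarrow> nat" and \<mu> :: "nat \<Rightarrow> real" and Q :: "nat \<Rightarrow> mat"
  assumes chain: "markov_chain M X \<mu> Q"
begin

lemma Q_stochastic: "n \<ge> 1 \<Longrightarrow> stochastic_mat states (Q n)"
  using chain by (simp add: markov_chain_def)

lemma X_measurable: "X n \<in> M \<rightarrow>\<^sub>M count_space states"
  using chain by (simp add: markov_chain_def)

lemma X_measurable_UNIV[measurable]: "X n \<in> M \<rightarrow>\<^sub>M count_space UNIV"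
  using measurable_compose[OF X_measurable, of "\<lambda>x. x" "count_space UNIV" n] by simp

lemma X_in_states: "\<omega> \<in> space M \<Longrightarrow> X n \<omega> \<in> states"
  using measurable_space[OF X_measurable, of \<omega> n] by simp

lemma history_measurable[measurable]: "history X n \<in> M \<rightarrow>\<^sub>M count_space UNIV"
proof (induction n)
  case 0
  show ?case using measurable_compose[OF X_measurable_UNIV, of "\<lambda>x. [x]" "count_space UNIV" 0] by simp
next
  case (Suc n)
  have "(\<lambda>\<omega>. X (Suc n) \<omega> # xs) \<in> M \<rightarrow>\<^sub>M count_space UNIV" for xs
    by (rule measurable_compose[OF X_measurable_UNIV]) simp
  then show ?case
    unfolding history.simps by (rule measurable_compose_countable[OF _ Suc])
qed

definition history_pmf :: "nat \<Rightarrow> nat list pmf" where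
  "history_pmf n = Abs_pmf (distr M (count_space UNIV) (history X n))"

lemma measure_history_pmf: "measure_pmf (history_pmf n) = distr M (count_space UNIV) (history X n)"
  unfolding history_pmf_def
proof (rule Abs_pmf_inverse, intro CollectI conjI)
  interpret D: prob_space "distr M (count_space UNIV) (history X n)"
    by (rule prob_space_distr) simp
  show "prob_space (distr M (count_space UNIV) (history X n))"
    by (rule prob_space_distr) simp
  show "AE x in distr M (count_space UNIV) (history X n). measure (distr M (count_space UNIV) (history X n)) {x} \<noteq> 0"
    by (subst D.AE_support_countable) (auto intro!: exI[of _ UNIV])
qed simp

lemma pmf_history: "pmf (history_pmf n) xs = prob {\<omega>\<in>space M. history X n \<omega> = xs}"
  unfolding pmf.rep_eq measure_history_pmf
  by (subst measure_distr) (auto intro!: arg_cong[where f=prob])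

lemma markov_property:
  assumes "\<forall>k\<le>Suc n. x k \<in> states" "prob {\<omega>\<in>space M. \<forall>k<Suc n. X k \<omega> = x k} > 0"
  shows "\<P>(\<omega> in M. X (Suc n) \<omega> = x (Suc n) \<bar> \<forall>k<Suc n. X k \<omega> = x k)
    = \<P>(\<omega> in M. X (Suc n) \<omega> = x (Suc n) \<bar> X n \<omega> = x n)"
proof -
  have "\<forall>n\<ge>1. \<forall>x. (\<forall>k\<le>n. x k \<in> states) \<longrightarrow> prob {\<omega>\<in>space M. \<forall>k<n. X k \<omega> = x k} > 0 \<longrightarrow>
        \<P>(\<omega> in M. X n \<omega> = x n \<bar> \<forall>k<n. X k \<omega> = x k) =
        \<P>(\<omega> in M. X n \<omega> = x n \<bar> X (n - 1) \<omega> = x (n - 1))"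
    using chain unfolding markov_chain_def by (elim conjE)
  from this[rule_format, of "Suc n" x] assms show ?thesis by simp
qed

lemma transition_prob:
  assumes "i \<in> states" "j \<in> states" "prob {\<omega>\<in>space M. X n \<omega> = i} > 0"
  shows "\<P>(\<omega> in M. X (Suc n) \<omega> = j \<bar> X n \<omega> = i) = Q (Suc n) i j"
proof -
  have "\<forall>n\<ge>1. \<forall>i\<in>states. \<forall>j\<in>states. prob {\<omega>\<in>space M. X (n - 1) \<omega> = i} > 0 \<longrightarrow>
        \<P>(\<omega> in M. X n \<omega> = j \<bar> X (n - 1) \<omega> = i) = Q n i j"
    using chain unfolding markov_chain_def by (elim conjE)
  from this[rule_format, of "Suc n" i j] assms show ?thesis by simp
qed

text \<open>The elementary conditional probabilities enter through this product formula. They are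
  constrained only for histories of positive probability; for the others both sides vanish.\<close>

lemma prob_history_Suc:
  "prob {\<omega>\<in>space M. history X (Suc n) \<omega> = j # xs} =
     prob {\<omega>\<in>space M. history X n \<omega> = xs} * pmf (row_pmf (Q (Suc n)) (hd xs)) j"
proof (cases "prob {\<omega>\<in>space M. history X n \<omega> = xs} = 0")
  case True
  have "prob {\<omega>\<in>space M. history X (Suc n) \<omega> = j # xs} \<le> prob {\<omega>\<in>space M. history X n \<omega> = xs}"
    by (intro finite_measure_mono) auto
  then show ?thesis using True by (simp add: measure_le_0_iff)
next
  case False
  then have "{\<omega>\<in>space M. history X n \<omega> = xs} \<noteq> {}" by (metis measure_empty)
  \<comment> \<open>A point of the event supplies the states of the path for the conditional probabilities.\<close>
  then obtain \<omega>0 where \<omega>0: "\<omega>0 \<in> space M" "xs = history X n \<omega>0" by auto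
  have hd: "hd xs = X n \<omega>0" by (simp add: \<omega>0 hd_history)
  have hd_states: "hd xs \<in> states" unfolding hd using X_in_states \<omega>0 by simp
  note row = pmf_row_pmf[OF Q_stochastic hd_states, of "Suc n" j, simplified]
  show ?thesis
  proof (cases "j \<in> states")
    case False
    then have "{\<omega>\<in>space M. history X (Suc n) \<omega> = j # xs} = {}" using X_in_states by auto
    moreover have "pmf (row_pmf (Q (Suc n)) (hd xs)) j = 0" using False row by simp
    ultimately show ?thesis by (simp only: mult_zero_right measure_empty)
  next
    case True
    define x where "x k = (if k \<le> n then X k \<omega>0 else j)" for k
    have x_states: "\<forall>k\<le>Suc n. x k \<in> states" using True X_in_states \<omega>0 by (simp add: x_def)
    have past: "{\<omega>\<in>space M. \<forall>k<Suc n. X k \<omega> = x k} = {\<omega>\<in>space M. history X n \<omega> = xs}"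
      by (auto simp: \<omega>0 history_eq_iff x_def)
    have pos: "prob {\<omega>\<in>space M. \<forall>k<Suc n. X k \<omega> = x k} > 0"
      unfolding past using False by (simp add: zero_less_measure_iff)
    have pos1: "prob {\<omega>\<in>space M. X n \<omega> = x n} > 0"
      by (rule less_le_trans[OF pos finite_measure_mono]) auto
    have "\<P>(\<omega> in M. X (Suc n) \<omega> = x (Suc n) \<bar> \<forall>k<Suc n. X k \<omega> = x k)
        = \<P>(\<omega> in M. X (Suc n) \<omega> = x (Suc n) \<bar> X n \<omega> = x n)"
      using x_states pos by (rule markov_property)
    also have "\<dots> = Q (Suc n) (x n) (x (Suc n))"
      using x_states pos1 by (intro transition_prob) auto
    finally have "prob {\<omega>\<in>space M. X (Suc n) \<omega> = x (Suc n) \<and> (\<forall>k<Suc n. X k \<omega> = x k)}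
        = prob {\<omega>\<in>space M. history X n \<omega> = xs} * Q (Suc n) (x n) (x (Suc n))"
      using pos unfolding cond_prob_def past by (simp add: field_simps)
    moreover have "{\<omega>\<in>space M. X (Suc n) \<omega> = x (Suc n) \<and> (\<forall>k<Suc n. X k \<omega> = x k)} =
        {\<omega>\<in>space M. history X (Suc n) \<omega> = j # xs}"
      using past by (auto simp: x_def)
    ultimately show ?thesis using True row by (simp add: x_def hd)
  qed
qed

lemma history_pmf_Suc:
  "history_pmf (Suc n) = bind_pmf (history_pmf n) (\<lambda>xs. map_pmf (\<lambda>j. j # xs) (row_pmf (Q (Suc n)) (hd xs)))"
    (is "_ = bind_pmf _ ?K")
proof (rule pmf_eqI)
  fix ys
  show "pmf (history_pmf (Suc n)) ys = pmf (bind_pmf (history_pmf n) ?K) ys"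
  proof (cases ys)
    case Nil
    have "[] \<notin> set_pmf (bind_pmf (history_pmf n) ?K)" by auto
    then show ?thesis by (simp add: Nil pmf_history pmf_eq_0_set_pmf)
  next
    case (Cons j xs)
    have K: "pmf (?K zs) (j # xs) = indicator {xs} zs * pmf (row_pmf (Q (Suc n)) (hd xs)) j" for zs
    proof (cases "zs = xs")
      case True
      have "inj (\<lambda>j. j # xs)" by (auto simp: inj_on_def)
      from pmf_map_inj'[OF this] show ?thesis by (simp add: True)
    next
      case False
      then show ?thesis by (subst pmf_map_outside) auto
    qed
    show ?thesis
      unfolding Cons pmf_bind K by (simp add: pmf_history prob_history_Suc measure_pmf_single del: history.simps)
  qed
qed

text \<open>The Markov property for functions of the whole history: the last state is integrated out with
  respect to the row of the transition matrix at the previous state.\<close>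

lemma nn_integral_history_Suc:
  fixes F :: "nat list \<Rightarrow> ennreal"
  shows "(\<integral>\<^sup>+\<omega>. F (history X (Suc n) \<omega>) \<partial>M) =
    (\<integral>\<^sup>+\<omega>. (\<integral>\<^sup>+j. F (j # history X n \<omega>) \<partial>row_pmf (Q (Suc n)) (X n \<omega>)) \<partial>M)"
proof -
  have distr: "(\<integral>\<^sup>+\<omega>. G (history X m \<omega>) \<partial>M) = (\<integral>\<^sup>+xs. G xs \<partial>history_pmf m)" for G :: "nat list \<Rightarrow> ennreal" and m
    unfolding measure_history_pmf by (rule nn_integral_distr[symmetric]) auto
  show ?thesis
    unfolding distr history_pmf_Suc
    using distr[of "\<lambda>xs. \<integral>\<^sup>+j. F (j # xs) \<partial>row_pmf (Q (Suc n)) (hd xs)" n] by (simp add: hd_history)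
qed

text \<open>The mean of \<open>g(X\<^bsub>n+1\<^esub>)\<close> is an average, over the law of \<open>X\<^sub>n\<close>, of the conditional means. The constant \<open>B\<close> is
  added to work with nonnegative functions.\<close>

lemma expectation_step_bounds:
  fixes g :: "nat \<Rightarrow> real"
  assumes g: "\<And>x. \<bar>g x\<bar> \<le> B"
    and row: "\<And>i. i \<in> states \<Longrightarrow> l \<le> measure_pmf.expectation (row_pmf (Q (Suc n)) i) g"
      "\<And>i. i \<in> states \<Longrightarrow> measure_pmf.expectation (row_pmf (Q (Suc n)) i) g \<le> u"
  shows "l \<le> expectation (\<lambda>\<omega>. g (X (Suc n) \<omega>))" "expectation (\<lambda>\<omega>. g (X (Suc n) \<omega>)) \<le> u"
proof -
  have gB: "0 \<le> g x + B" for x using g[of x] by linarith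
  have int: "integrable M (\<lambda>\<omega>. g (X (Suc n) \<omega>))"
    using g by (intro integrable_const_bound[where B=B]) auto
  have E0: "0 \<le> expectation (\<lambda>\<omega>. g (X (Suc n) \<omega>)) + B"
  proof -
    have "0 \<le> expectation (\<lambda>\<omega>. g (X (Suc n) \<omega>) + B)" using gB by simp
    then show ?thesis using int by (simp add: prob_space)
  qed
  have "ennreal (expectation (\<lambda>\<omega>. g (X (Suc n) \<omega>)) + B) = (\<integral>\<^sup>+\<omega>. ennreal (g (X (Suc n) \<omega>) + B) \<partial>M)"
    using int gB by (subst nn_integral_eq_integral) (auto simp: prob_space)
  also have "\<dots> = (\<integral>\<^sup>+\<omega>. ennreal (g (hd (history X (Suc n) \<omega>)) + B) \<partial>M)" by simp
  also have "\<dots> = (\<integral>\<^sup>+\<omega>. (\<integral>\<^sup>+j. ennreal (g j + B) \<partial>row_pmf (Q (Suc n)) (X n \<omega>)) \<partial>M)"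
    by (subst nn_integral_history_Suc) simp
  also have "\<dots> = (\<integral>\<^sup>+\<omega>. ennreal (measure_pmf.expectation (row_pmf (Q (Suc n)) (X n \<omega>)) g + B) \<partial>M)"
    using bounded_integrable_pmf[of g B] g gB by (subst nn_integral_eq_integral) auto
  finally have eq: "ennreal (expectation (\<lambda>\<omega>. g (X (Suc n) \<omega>)) + B) =
    (\<integral>\<^sup>+\<omega>. ennreal (measure_pmf.expectation (row_pmf (Q (Suc n)) (X n \<omega>)) g + B) \<partial>M)" .
  have "(\<integral>\<^sup>+\<omega>. ennreal (measure_pmf.expectation (row_pmf (Q (Suc n)) (X n \<omega>)) g + B) \<partial>M) \<le> (\<integral>\<^sup>+\<omega>. ennreal (u + B) \<partial>M)"
    using row(2) X_in_states by (intro nn_integral_mono ennreal_leI) auto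
  then have "ennreal (expectation (\<lambda>\<omega>. g (X (Suc n) \<omega>)) + B) \<le> ennreal (u + B)"
    unfolding eq by (simp add: emeasure_space_1)
  moreover have "0 \<le> u + B"
  proof -
    have "0 \<le> measure_pmf.expectation (row_pmf (Q (Suc n)) 1) (\<lambda>x. g x + B)" using gB by simp
    then have "0 \<le> measure_pmf.expectation (row_pmf (Q (Suc n)) 1) g + B" using bounded_integrable_pmf[of g B] g by simp
    then show ?thesis using row(2)[of 1] by simp
  qed
  ultimately show "expectation (\<lambda>\<omega>. g (X (Suc n) \<omega>)) \<le> u" by (simp add: ennreal_le_iff)
  have "(\<integral>\<^sup>+\<omega>. ennreal (l + B) \<partial>M) \<le> (\<integral>\<^sup>+\<omega>. ennreal (measure_pmf.expectation (row_pmf (Q (Suc n)) (X n \<omega>)) g + B) \<partial>M)"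
    using row(1) X_in_states by (intro nn_integral_mono ennreal_leI) auto
  then have "ennreal (l + B) \<le> ennreal (expectation (\<lambda>\<omega>. g (X (Suc n) \<omega>)) + B)"
    unfolding eq by (simp add: emeasure_space_1)
  then show "l \<le> expectation (\<lambda>\<omega>. g (X (Suc n) \<omega>))" using E0 by (simp add: ennreal_le_iff)
qed

lemma nn_integral_prod_Suc:
  fixes \<phi> :: "nat \<Rightarrow> nat \<Rightarrow> real"
  assumes nonneg: "\<And>k x. 0 \<le> \<phi> k x" and bounded: "\<And>k x. \<phi> k x \<le> B k"
  shows "(\<integral>\<^sup>+\<omega>. ennreal (\<Prod>k=1..Suc n. \<phi> k (X k \<omega>)) \<partial>M) =
    (\<integral>\<^sup>+\<omega>. ennreal (\<Prod>k=1..n. \<phi> k (X k \<omega>)) *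
       ennreal (measure_pmf.expectation (row_pmf (Q (Suc n)) (X n \<omega>)) (\<phi> (Suc n))) \<partial>M)"
proof -
  define F where "F xs = ennreal (\<Prod>k=1..Suc n. \<phi> k (xs ! (Suc n - k)))" for xs
  have F: "F (history X (Suc n) \<omega>) = ennreal (\<Prod>k=1..Suc n. \<phi> k (X k \<omega>))" for \<omega>
    unfolding F_def by (intro arg_cong[where f=ennreal] prod.cong refl arg_cong[where f="\<phi> _"] history_nth) auto
  have F_Cons: "F (j # history X n \<omega>) = ennreal (\<Prod>k=1..n. \<phi> k (X k \<omega>)) * ennreal (\<phi> (Suc n) j)" for j \<omega>
  proof -
    have "(\<Prod>k=1..n. \<phi> k ((j # history X n \<omega>) ! (Suc n - k))) = (\<Prod>k=1..n. \<phi> k (X k \<omega>))"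
      by (intro prod.cong refl) (auto simp: Suc_diff_le history_nth)
    then show ?thesis unfolding F_def using nonneg by (simp add: ennreal_mult prod_nonneg)
  qed
  have int: "(\<integral>\<^sup>+j. ennreal (\<phi> (Suc n) j) \<partial>measure_pmf p) = ennreal (measure_pmf.expectation p (\<phi> (Suc n)))" for p
    using nonneg bounded by (intro nn_integral_eq_integral bounded_integrable_pmf[of _ "B (Suc n)"]) auto
  show ?thesis
    unfolding F[symmetric] nn_integral_history_Suc F_Cons by (simp add: nn_integral_cmult int)
qed

text \<open>Bounds on the conditional expectations that hold for every state multiply, although the factors
  are dependent: integrating out the last state costs at most the factor \<open>u\<close> and at least the factor \<open>l\<close>.\<close>

lemma expectation_prod_bounds:
  fixes \<phi> :: "nat \<Rightarrow> nat \<Rightarrow> real"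
  assumes nonneg: "\<And>k x. 0 \<le> \<phi> k x" and bounded: "\<And>k x. \<phi> k x \<le> B k"
    and l_nonneg: "\<And>k. 0 \<le> l k"
    and row: "\<And>k i. k \<ge> 1 \<Longrightarrow> i \<in> states \<Longrightarrow> l k \<le> measure_pmf.expectation (row_pmf (Q k) i) (\<phi> k)"
      "\<And>k i. k \<ge> 1 \<Longrightarrow> i \<in> states \<Longrightarrow> measure_pmf.expectation (row_pmf (Q k) i) (\<phi> k) \<le> u k"
  shows "(\<Prod>k=1..n. l k) \<le> expectation (\<lambda>\<omega>. \<Prod>k=1..n. \<phi> k (X k \<omega>))"
    and "expectation (\<lambda>\<omega>. \<Prod>k=1..n. \<phi> k (X k \<omega>)) \<le> (\<Prod>k=1..n. u k)"
proof -
  have lu: "l k \<le> u k" if "k \<ge> 1" for k using row[OF that, of 1] by fastforce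
  then have u_nonneg: "0 \<le> u k" if "k \<ge> 1" for k using that l_nonneg[of k] by fastforce
  have "ennreal (\<Prod>k=1..n. l k) \<le> (\<integral>\<^sup>+\<omega>. ennreal (\<Prod>k=1..n. \<phi> k (X k \<omega>)) \<partial>M) \<and>
     (\<integral>\<^sup>+\<omega>. ennreal (\<Prod>k=1..n. \<phi> k (X k \<omega>)) \<partial>M) \<le> ennreal (\<Prod>k=1..n. u k)"
  proof (induction n)
    case 0
    then show ?case by (simp add: emeasure_space_1)
  next
    case (Suc n)
    let ?P = "\<lambda>\<omega>. ennreal (\<Prod>k=1..n. \<phi> k (X k \<omega>))"
    let ?E = "\<lambda>\<omega>. ennreal (measure_pmf.expectation (row_pmf (Q (Suc n)) (X n \<omega>)) (\<phi> (Suc n)))"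
    have meas: "?P \<in> borel_measurable M" by measurable
    have "ennreal (\<Prod>k=1..Suc n. l k) = ennreal (\<Prod>k=1..n. l k) * ennreal (l (Suc n))"
      using l_nonneg by (simp add: ennreal_mult prod_nonneg)
    also have "\<dots> \<le> (\<integral>\<^sup>+\<omega>. ?P \<omega> \<partial>M) * ennreal (l (Suc n))"
      using Suc by (intro mult_right_mono) auto
    also have "\<dots> = (\<integral>\<^sup>+\<omega>. ?P \<omega> * ennreal (l (Suc n)) \<partial>M)" by (rule nn_integral_multc[OF meas, symmetric])
    also have "\<dots> \<le> (\<integral>\<^sup>+\<omega>. ?P \<omega> * ?E \<omega> \<partial>M)"
      using X_in_states by (intro nn_integral_mono mult_left_mono ennreal_leI row) auto
    finally have lower: "ennreal (\<Prod>k=1..Suc n. l k) \<le> (\<integral>\<^sup>+\<omega>. ?P \<omega> * ?E \<omega> \<partial>M)" .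
    have "(\<integral>\<^sup>+\<omega>. ?P \<omega> * ?E \<omega> \<partial>M) \<le> (\<integral>\<^sup>+\<omega>. ?P \<omega> * ennreal (u (Suc n)) \<partial>M)"
      using X_in_states by (intro nn_integral_mono mult_left_mono ennreal_leI row) auto
    also have "\<dots> = (\<integral>\<^sup>+\<omega>. ?P \<omega> \<partial>M) * ennreal (u (Suc n))" by (rule nn_integral_multc[OF meas])
    also have "\<dots> \<le> ennreal (\<Prod>k=1..n. u k) * ennreal (u (Suc n))"
      using Suc by (intro mult_right_mono) auto
    also have "\<dots> = ennreal (\<Prod>k=1..Suc n. u k)"
      using u_nonneg by (subst ennreal_mult[symmetric]) (auto intro!: prod_nonneg)
    finally have upper: "(\<integral>\<^sup>+\<omega>. ?P \<omega> * ?E \<omega> \<partial>M) \<le> ennreal (\<Prod>k=1..Suc n. u k)" .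
    show ?case
      unfolding nn_integral_prod_Suc[where \<phi>=\<phi> and B=B, OF nonneg bounded] using lower upper by (rule conjI)
  qed
  moreover have "(\<integral>\<^sup>+\<omega>. ennreal (\<Prod>k=1..n. \<phi> k (X k \<omega>)) \<partial>M) = ennreal (expectation (\<lambda>\<omega>. \<Prod>k=1..n. \<phi> k (X k \<omega>)))"
  proof (rule nn_integral_eq_integral)
    have le: "(\<Prod>k=1..n. \<phi> k (X k \<omega>)) \<le> (\<Prod>k=1..n. B k)" for \<omega>
      using nonneg bounded by (intro prod_mono) auto
    show "integrable M (\<lambda>\<omega>. \<Prod>k=1..n. \<phi> k (X k \<omega>))"
      by (rule integrable_const_bound[where B="\<Prod>k=1..n. B k"]) (use le nonneg in \<open>auto simp: prod_nonneg abs_prod\<close>)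
    show "AE \<omega> in M. 0 \<le> (\<Prod>k=1..n. \<phi> k (X k \<omega>))" using nonneg by (simp add: prod_nonneg)
  qed
  moreover have "0 \<le> expectation (\<lambda>\<omega>. \<Prod>k=1..n. \<phi> k (X k \<omega>))" "0 \<le> (\<Prod>k=1..n. u k)"
    using nonneg u_nonneg by (auto intro!: prod_nonneg integral_nonneg_AE AE_I2)
  ultimately show "(\<Prod>k=1..n. l k) \<le> expectation (\<lambda>\<omega>. \<Prod>k=1..n. \<phi> k (X k \<omega>))"
    "expectation (\<lambda>\<omega>. \<Prod>k=1..n. \<phi> k (X k \<omega>)) \<le> (\<Prod>k=1..n. u k)"
    by (simp_all add: ennreal_le_iff)
qed

end

section \<open>The log moment generating function of the centred sums\<close>

lemma (in prob_space) abs_expectation_le: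
  fixes h :: "'a \<Rightarrow> real"
  assumes h: "\<And>x. \<bar>h x\<bar> \<le> B"
  shows "\<bar>expectation h\<bar> \<le> B"
proof -
  have "0 \<le> B" using h[of undefined] by linarith
  have "\<bar>expectation h\<bar> \<le> expectation (\<lambda>x. \<bar>h x\<bar>)" by (rule integral_abs_bound)
  also have "\<dots> \<le> expectation (\<lambda>_. B)" using h \<open>0 \<le> B\<close> by (intro integral_mono') auto
  finally show ?thesis by (simp add: prob_space)
qed

lemma exp_second_order:
  fixes u :: real
  assumes "\<bar>u\<bar> \<le> 1"
  shows "\<bar>exp u - (1 + u + u\<^sup>2 / 2)\<bar> \<le> 3 / 2 * \<bar>u\<bar> ^ 3"
proof -
  have "(\<Sum>i\<le>2. u ^ i / fact i) = 1 + u + u\<^sup>2 / 2"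
    by (simp add: numeral_2_eq_2)
  then have "\<bar>exp u - (1 + u + u\<^sup>2 / 2)\<bar> \<le> exp \<bar>u\<bar> * \<bar>u\<bar> ^ 3 / 2"
    using Taylor_exp_field[of u 2] by (simp add: power3_eq_cube power2_eq_square numeral_2_eq_2)
  moreover have "exp \<bar>u\<bar> \<le> 3" using assms exp_le by (meson exp_le_cancel_iff order_trans)
  then have "exp \<bar>u\<bar> * \<bar>u\<bar> ^ 3 \<le> 3 * \<bar>u\<bar> ^ 3" by (intro mult_right_mono) auto
  ultimately show ?thesis by linarith
qed

text \<open>Here \<open>q\<close> is a row of a transition matrix, \<open>p\<close> the common row of the limit matrix and \<open>m\<close> the constant used for
  centring. Expand the exponential to second order. The linear term \<open>t (E\<^sub>q g - m)\<close> is the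
  reason for the error \<open>\<bar>t\<bar> \<delta>\<close>; in the quadratic term, \<open>E\<^sub>q (g - m)\<^sup>2\<close> is the variance under \<open>q\<close>, which is close to
  the one under \<open>p\<close>, plus \<open>(E\<^sub>q g - m)\<^sup>2\<close>.\<close>

lemma pmf_mgf_estimate:
  fixes g :: "'b \<Rightarrow> real" and p q :: "'b pmf"
  assumes K: "K \<ge> 1" and g: "\<And>x. \<bar>g x\<bar> \<le> K" and m: "\<bar>m\<bar> \<le> K" and t: "\<bar>t\<bar> * (2 * K) \<le> 1"
    and \<delta>: "0 \<le> \<delta>" "\<bar>measure_pmf.expectation q g - m\<bar> \<le> 2 * K * \<delta>"
    and \<epsilon>: "0 \<le> \<epsilon>" "\<bar>measure_pmf.expectation q g - measure_pmf.expectation p g\<bar> \<le> K * \<epsilon>"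
      "\<bar>measure_pmf.expectation q (\<lambda>x. (g x)\<^sup>2) - measure_pmf.expectation p (\<lambda>x. (g x)\<^sup>2)\<bar> \<le> K\<^sup>2 * \<epsilon>"
  shows "\<bar>measure_pmf.expectation q (\<lambda>x. exp (t * (g x - m))) - 1
      - t\<^sup>2 / 2 * (measure_pmf.expectation p (\<lambda>x. (g x)\<^sup>2) - (measure_pmf.expectation p g)\<^sup>2)\<bar>
     \<le> 16 * K ^ 3 * (\<bar>t\<bar> * \<delta> + t\<^sup>2 * \<epsilon> + \<bar>t\<bar> ^ 3)"
proof -
  define A S A0 S0 where "A = measure_pmf.expectation q g" and "S = measure_pmf.expectation q (\<lambda>x. (g x)\<^sup>2)"
    and "A0 = measure_pmf.expectation p g" and "S0 = measure_pmf.expectation p (\<lambda>x. (g x)\<^sup>2)"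
  have y: "\<bar>g x - m\<bar> \<le> 2 * K" for x using g[of x] m by linarith
  have ty: "\<bar>t * (g x - m)\<bar> \<le> \<bar>t\<bar> * (2 * K)" for x
    unfolding abs_mult by (intro mult_left_mono y) auto
  have g2: "\<bar>(g x)\<^sup>2\<bar> \<le> K\<^sup>2" for x using g[of x] K by (simp add: abs_le_square_iff[symmetric])
  have int_g: "integrable (measure_pmf r) g" and int_g2: "integrable (measure_pmf r) (\<lambda>x. (g x)\<^sup>2)" for r
    using bounded_integrable_pmf[of g K] bounded_integrable_pmf[of "\<lambda>x. (g x)\<^sup>2" "K\<^sup>2"] g g2 by auto
  have int_e: "integrable (measure_pmf q) (\<lambda>x. exp (t * (g x - m)))"
  proof (rule bounded_integrable_pmf)
    show "\<bar>exp (t * (g x - m))\<bar> \<le> exp 1" for x using ty[of x] t by simp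
  qed
  let ?T = "\<lambda>x. (1 - t * m + t\<^sup>2 / 2 * m\<^sup>2) + ((t - t\<^sup>2 * m) * g x + t\<^sup>2 / 2 * (g x)\<^sup>2)"
  have int_T: "integrable (measure_pmf q) ?T"
    using int_g[of q] int_g2[of q] by simp
  have T: "1 + t * (g x - m) + (t * (g x - m))\<^sup>2 / 2 = ?T x" for x
    by (simp add: power2_eq_square field_simps)
  have ET: "measure_pmf.expectation q ?T = 1 + t * (A - m) + t\<^sup>2 / 2 * (S - A\<^sup>2 + (A - m)\<^sup>2)"
  proof -
    have "measure_pmf.expectation q ?T = (1 - t * m + t\<^sup>2 / 2 * m\<^sup>2) + ((t - t\<^sup>2 * m) * A + t\<^sup>2 / 2 * S)"
      using int_g[of q] int_g2[of q] by (simp add: A_def S_def)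
    also have "\<dots> = 1 + t * (A - m) + t\<^sup>2 / 2 * (S - A\<^sup>2 + (A - m)\<^sup>2)"
      by (simp add: power2_eq_square field_simps)
    finally show ?thesis .
  qed
  have A_K: "\<bar>A\<bar> \<le> K" "\<bar>A0\<bar> \<le> K"
    unfolding A_def A0_def by (intro measure_pmf.abs_expectation_le g)+
  have "\<bar>measure_pmf.expectation q (\<lambda>x. exp (t * (g x - m))) - measure_pmf.expectation q ?T\<bar> \<le> 12 * K ^ 3 * \<bar>t\<bar> ^ 3"
  proof -
    have pw: "\<bar>exp (t * (g x - m)) - ?T x\<bar> \<le> 12 * K ^ 3 * \<bar>t\<bar> ^ 3" for x
    proof -
      have "\<bar>exp (t * (g x - m)) - ?T x\<bar> \<le> 3 / 2 * \<bar>t * (g x - m)\<bar> ^ 3"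
        using exp_second_order[of "t * (g x - m)"] ty[of x] t unfolding T by linarith
      also have "\<dots> \<le> 3 / 2 * (\<bar>t\<bar> * (2 * K)) ^ 3"
        by (intro mult_left_mono power_mono ty) auto
      finally show ?thesis by (simp add: power_mult_distrib)
    qed
    have "\<bar>measure_pmf.expectation q (\<lambda>x. exp (t * (g x - m)) - ?T x)\<bar> \<le> 12 * K ^ 3 * \<bar>t\<bar> ^ 3"
      using pw by (rule measure_pmf.abs_expectation_le)
    then show ?thesis by (subst (asm) Bochner_Integration.integral_diff[OF int_e int_T])
  qed
  moreover have "\<bar>t * (A - m)\<bar> \<le> 2 * K ^ 3 * (\<bar>t\<bar> * \<delta>)"
  proof -
    have "\<bar>t * (A - m)\<bar> \<le> \<bar>t\<bar> * (2 * K * \<delta>)"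
      unfolding abs_mult using \<delta> by (intro mult_left_mono) (auto simp: A_def)
    also have "\<dots> = 2 * K ^ 1 * (\<bar>t\<bar> * \<delta>)" by simp
    also have "\<dots> \<le> 2 * K ^ 3 * (\<bar>t\<bar> * \<delta>)"
      using K \<delta> by (intro mult_right_mono mult_left_mono power_increasing) auto
    finally show ?thesis .
  qed
  moreover have "\<bar>t\<^sup>2 / 2 * (A - m)\<^sup>2\<bar> \<le> 2 * K ^ 3 * (\<bar>t\<bar> * \<delta>)"
  proof -
    have Am: "\<bar>A - m\<bar> \<le> 2 * K" using A_K m by linarith
    have "\<bar>t\<^sup>2 / 2 * (A - m)\<^sup>2\<bar> = \<bar>t\<bar> / 2 * ((\<bar>t\<bar> * \<bar>A - m\<bar>) * \<bar>A - m\<bar>)"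
      by (simp add: power2_eq_square abs_mult)
    also have "\<dots> \<le> \<bar>t\<bar> / 2 * (1 * (2 * K * \<delta>))"
    proof (intro mult_left_mono mult_mono)
      show "\<bar>t\<bar> * \<bar>A - m\<bar> \<le> 1" using mult_left_mono[OF Am, of "\<bar>t\<bar>"] t by linarith
      show "\<bar>A - m\<bar> \<le> 2 * K * \<delta>" using \<delta> by (simp add: A_def)
    qed auto
    also have "\<dots> = K ^ 1 * (\<bar>t\<bar> * \<delta>)" by simp
    also have "\<dots> \<le> K ^ 3 * (\<bar>t\<bar> * \<delta>)"
      using K \<delta> by (intro mult_right_mono power_increasing) auto
    also have "\<dots> \<le> 2 * K ^ 3 * (\<bar>t\<bar> * \<delta>)" using K \<delta> by simp
    finally show ?thesis .
  qed
  moreover have "\<bar>t\<^sup>2 / 2 * ((S - S0) - (A\<^sup>2 - A0\<^sup>2))\<bar> \<le> 2 * K ^ 3 * (t\<^sup>2 * \<epsilon>)"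
  proof -
    have "\<bar>A\<^sup>2 - A0\<^sup>2\<bar> = \<bar>A - A0\<bar> * \<bar>A + A0\<bar>"
      by (simp add: abs_mult[symmetric] power2_eq_square algebra_simps)
    also have "\<dots> \<le> (K * \<epsilon>) * (2 * K)"
      using \<epsilon> A_K by (intro mult_mono) (auto simp: A_def A0_def)
    finally have "\<bar>(S - S0) - (A\<^sup>2 - A0\<^sup>2)\<bar> \<le> K\<^sup>2 * \<epsilon> + (K * \<epsilon>) * (2 * K)"
      using \<epsilon>(3) unfolding S_def[symmetric] S0_def[symmetric] by linarith
    also have "\<dots> = 3 * K\<^sup>2 * \<epsilon>" by (simp add: power2_eq_square)
    finally have "t\<^sup>2 / 2 * \<bar>(S - S0) - (A\<^sup>2 - A0\<^sup>2)\<bar> \<le> t\<^sup>2 / 2 * (3 * K\<^sup>2 * \<epsilon>)"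
      by (intro mult_left_mono) auto
    also have "\<dots> = 3 / 2 * (K\<^sup>2 * (t\<^sup>2 * \<epsilon>))" by simp
    also have "\<dots> \<le> 2 * (K ^ 3 * (t\<^sup>2 * \<epsilon>))"
    proof -
      have "K\<^sup>2 * (t\<^sup>2 * \<epsilon>) \<le> K ^ 3 * (t\<^sup>2 * \<epsilon>)"
        using K \<epsilon> by (intro mult_right_mono power_increasing) auto
      moreover have "0 \<le> K\<^sup>2 * (t\<^sup>2 * \<epsilon>)" using \<epsilon> by simp
      ultimately show ?thesis by linarith
    qed
    finally show ?thesis by (simp add: abs_mult)
  qed
  moreover have "measure_pmf.expectation q ?T - 1 - t\<^sup>2 / 2 * (S0 - A0\<^sup>2)
      = t * (A - m) + t\<^sup>2 / 2 * (A - m)\<^sup>2 + t\<^sup>2 / 2 * ((S - S0) - (A\<^sup>2 - A0\<^sup>2))"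
    unfolding ET by (simp add: field_simps)
  ultimately have "\<bar>measure_pmf.expectation q (\<lambda>x. exp (t * (g x - m))) - 1 - t\<^sup>2 / 2 * (S0 - A0\<^sup>2)\<bar>
      \<le> 12 * (K ^ 3 * \<bar>t\<bar> ^ 3) + 4 * (K ^ 3 * (\<bar>t\<bar> * \<delta>)) + 2 * (K ^ 3 * (t\<^sup>2 * \<epsilon>))"
    by linarith
  also have "\<dots> \<le> 16 * (K ^ 3 * \<bar>t\<bar> ^ 3) + 16 * (K ^ 3 * (\<bar>t\<bar> * \<delta>)) + 16 * (K ^ 3 * (t\<^sup>2 * \<epsilon>))"
    using K \<delta> \<epsilon> by (intro add_mono mult_right_mono) auto
  also have "\<dots> = 16 * K ^ 3 * (\<bar>t\<bar> * \<delta> + t\<^sup>2 * \<epsilon> + \<bar>t\<bar> ^ 3)" by (simp add: algebra_simps)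
  finally show ?thesis by (simp add: S0_def A0_def)
qed

text \<open>The condition on \<open>t\<close> keeps both \<open>C e\<close> and \<open>t\<^sup>2 \<theta> / 2\<close> at most \<open>1 / 2\<close>. Passing to the logarithm
  costs \<open>2 x\<^sup>2\<close> with \<open>x = t\<^sup>2 \<theta> / 2 - C e\<close>. Since \<open>e\<close> is at most \<open>4 \<bar>t\<bar>\<close>, this square is again
  bounded by a multiple of \<open>e\<close>, so that the error keeps its form.\<close>

lemma ln_row_bounds:
  fixes t \<theta> C \<delta> \<epsilon> :: real
  assumes C: "C \<ge> 1" and \<theta>: "\<theta> \<ge> 0" and \<delta>: "0 \<le> \<delta>" "\<delta> \<le> 1" and \<epsilon>: "0 \<le> \<epsilon>" "\<epsilon> \<le> 2"
    and t: "\<bar>t\<bar> * (8 * C + \<theta>) \<le> 1"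
  defines "e \<equiv> \<bar>t\<bar> * \<delta> + t\<^sup>2 * \<epsilon> + \<bar>t\<bar> ^ 3"
  shows "0 < 1 + t\<^sup>2 / 2 * \<theta> - C * e"
    and "t\<^sup>2 / 2 * \<theta> - (C + \<theta>\<^sup>2 + 16 * C\<^sup>2) * e \<le> ln (1 + t\<^sup>2 / 2 * \<theta> - C * e)"
proof -
  have t1: "\<bar>t\<bar> * (8 * C) \<le> 1" "\<bar>t\<bar> * \<theta> \<le> 1"
  proof -
    have "0 \<le> \<bar>t\<bar> * (8 * C)" "0 \<le> \<bar>t\<bar> * \<theta>" using C \<theta> by simp_all
    then show "\<bar>t\<bar> * (8 * C) \<le> 1" "\<bar>t\<bar> * \<theta> \<le> 1" using t unfolding distrib_left by linarith+
  qed
  have "\<bar>t\<bar> * 1 \<le> \<bar>t\<bar> * (8 * C)" using C by (intro mult_left_mono) auto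
  then have t_le_1: "\<bar>t\<bar> \<le> 1" using t1 by linarith
  have t2: "t\<^sup>2 \<le> \<bar>t\<bar>" using mult_left_mono[OF t_le_1, of "\<bar>t\<bar>"] by (simp add: power2_eq_square)
  have t3: "\<bar>t\<bar> ^ 3 \<le> \<bar>t\<bar>" using t_le_1 power_decreasing[of 1 3 "\<bar>t\<bar>"] by simp
  have t4: "(t\<^sup>2)\<^sup>2 \<le> \<bar>t\<bar> ^ 3" using t_le_1 power_decreasing[of 3 4 "\<bar>t\<bar>"] by simp
  have e0: "0 \<le> e" using \<delta> \<epsilon> by (simp add: e_def)
  have "e \<le> \<bar>t\<bar> * 1 + \<bar>t\<bar> * 2 + \<bar>t\<bar>"
    unfolding e_def using \<delta> \<epsilon> t2 t3 by (intro add_mono mult_mono) auto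
  then have e4: "e \<le> 4 * \<bar>t\<bar>" by simp
  have Ce: "C * e \<le> 4 * C * \<bar>t\<bar>" using mult_left_mono[OF e4, of C] C by simp
  have "\<bar>t\<bar> * (8 * C) = 2 * (4 * C * \<bar>t\<bar>)" by simp
  then have "4 * C * \<bar>t\<bar> \<le> 1 / 2" using t1 by linarith
  then have Ce_half: "C * e \<le> 1 / 2" using Ce by linarith
  have "t\<^sup>2 * \<theta> \<le> \<bar>t\<bar> * \<theta>" using t2 \<theta> by (rule mult_right_mono)
  then have \<theta>_half: "t\<^sup>2 / 2 * \<theta> \<le> 1 / 2" using t1 by simp
  have nonneg: "0 \<le> C * e" "0 \<le> t\<^sup>2 / 2 * \<theta>" using C e0 \<theta> by auto
  show pos: "0 < 1 + t\<^sup>2 / 2 * \<theta> - C * e" using Ce_half nonneg by linarith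
  define x where "x = t\<^sup>2 / 2 * \<theta> - C * e"
  have x_half: "\<bar>x\<bar> \<le> 1 / 2" unfolding x_def using Ce_half \<theta>_half nonneg by linarith
  have "x - 2 * x\<^sup>2 \<le> ln (1 + x)" using abs_ln_one_plus_x_minus_x_bound[OF x_half] by linarith
  moreover have "2 * x\<^sup>2 \<le> (\<theta>\<^sup>2 + 16 * C\<^sup>2) * e"
  proof -
    have "0 \<le> (t\<^sup>2 / 2 * \<theta> + C * e)\<^sup>2" by simp
    then have "2 * x\<^sup>2 \<le> \<theta>\<^sup>2 * (t\<^sup>2)\<^sup>2 + 4 * (C * e)\<^sup>2"
      unfolding x_def by (simp add: power2_eq_square field_simps)
    also have "\<theta>\<^sup>2 * (t\<^sup>2)\<^sup>2 \<le> \<theta>\<^sup>2 * e"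
    proof (rule mult_left_mono)
      have "\<bar>t\<bar> ^ 3 \<le> e" using \<delta> \<epsilon> by (simp add: e_def)
      then show "(t\<^sup>2)\<^sup>2 \<le> e" using t4 by linarith
    qed simp
    also have "4 * (C * e)\<^sup>2 \<le> 16 * C\<^sup>2 * e"
    proof -
      have "e * e \<le> 4 * e" using e4 e0 t_le_1 by (intro mult_right_mono) auto
      then have "C\<^sup>2 * (e * e) \<le> C\<^sup>2 * (4 * e)" by (intro mult_left_mono) auto
      then show ?thesis by (simp add: power2_eq_square mult_ac)
    qed
    finally show ?thesis by (simp add: distrib_right)
  qed
  ultimately have "x - (\<theta>\<^sup>2 + 16 * C\<^sup>2) * e \<le> ln (1 + x)" by linarith
  moreover have "1 + t\<^sup>2 / 2 * \<theta> - C * e = 1 + x"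
    "t\<^sup>2 / 2 * \<theta> - (C + \<theta>\<^sup>2 + 16 * C\<^sup>2) * e = x - (\<theta>\<^sup>2 + 16 * C\<^sup>2) * e"
    by (simp_all add: x_def distrib_right)
  ultimately show "t\<^sup>2 / 2 * \<theta> - (C + \<theta>\<^sup>2 + 16 * C\<^sup>2) * e \<le> ln (1 + t\<^sup>2 / 2 * \<theta> - C * e)"
    by (simp only:)
qed

context nonhomogeneous_chain
begin

text \<open>The exponential of the centred sum is the product of the factors \<open>exp (t (g(X\<^sub>k) - m\<^sub>k))\<close> with
  \<open>m\<^sub>k = E g(X\<^sub>k)\<close>. The mean \<open>m\<^sub>k\<close> is an average of the conditional means, which differ from each other by at most
  \<open>2 K \<delta>(Q\<^sub>k)\<close>; so each factor has a conditional expectation close to \<open>1 + t\<^sup>2 \<theta> / 2\<close>, uniformly in the state.\<close>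

lemma centered_log_mgf_estimate:
  fixes g :: "nat \<Rightarrow> real" and P :: mat and n :: nat
  assumes K: "K \<ge> 1" and g: "\<And>x. \<bar>g x\<bar> \<le> K"
    and P: "stochastic_mat states P" and P_const: "\<And>i. i \<in> states \<Longrightarrow> row_pmf P i = p"
    and \<theta>: "\<theta> = measure_pmf.expectation p (\<lambda>x. (g x)\<^sup>2) - (measure_pmf.expectation p g)\<^sup>2" "\<theta> \<ge> 0"
  defines "C \<equiv> 16 * K ^ 3"
  assumes t: "\<bar>t\<bar> * (8 * C + \<theta>) \<le> 1"
  defines "S \<equiv> \<lambda>\<omega>. \<Sum>k=1..n. g (X k \<omega>)"
  shows "\<bar>ln (expectation (\<lambda>\<omega>. exp (t * (S \<omega> - expectation S)))) - real n * (t\<^sup>2 / 2 * \<theta>)\<bar>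
     \<le> (C + \<theta>\<^sup>2 + 16 * C\<^sup>2) * (\<bar>t\<bar> * (\<Sum>k=1..n. ergodic_coeff states (Q k))
        + t\<^sup>2 * (\<Sum>k=1..n. mat_norm states (mat_diff (Q k) P)) + real n * \<bar>t\<bar> ^ 3)"
proof -
  define \<delta> \<epsilon> where "\<delta> k = ergodic_coeff states (Q k)" and "\<epsilon> k = mat_norm states (mat_diff (Q k) P)" for k
  define m where "m k = expectation (\<lambda>\<omega>. g (X k \<omega>))" for k
  define \<phi> where "\<phi> k x = exp (t * (g x - m k))" for k x
  define e where "e k = \<bar>t\<bar> * \<delta> k + t\<^sup>2 * \<epsilon> k + \<bar>t\<bar> ^ 3" for k
  define D where "D = C + \<theta>\<^sup>2 + 16 * C\<^sup>2"
  have "1 ^ 3 \<le> K ^ 3" using K by (intro power_mono) auto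
  then have C1: "C \<ge> 1" by (simp add: C_def)
  have int_g: "integrable M (\<lambda>\<omega>. g (X k \<omega>))" for k
    using g by (intro integrable_const_bound[where B=K]) auto
  have m_K: "\<bar>m k\<bar> \<le> K" for k
    unfolding m_def using g by (rule abs_expectation_le)
  have K3: "K \<le> K ^ 3" using K power_increasing[of 1 3 K] by simp
  have "\<bar>t\<bar> * (2 * K) \<le> \<bar>t\<bar> * (8 * C + \<theta>)"
    using K3 \<theta>(2) K by (intro mult_left_mono) (auto simp: C_def)
  then have tK: "\<bar>t\<bar> * (2 * K) \<le> 1" using t by linarith
  have \<delta>: "0 \<le> \<delta> k" "\<delta> k \<le> 1" and \<epsilon>: "0 \<le> \<epsilon> k" "\<epsilon> k \<le> 2" if "k \<ge> 1" for k
    using ergodic_coeff_nonneg[OF Q_stochastic[OF that]] mat_norm_nonneg[OF Q_stochastic[OF that] P]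
      row_pos_diff_le_ergodic_coeff(2)[OF Q_stochastic[OF that], of 1 1]
      row_dist_le_mat_norm(2)[OF Q_stochastic[OF that] P, of 1]
    by (auto simp: \<delta>_def \<epsilon>_def)
  have row: "\<bar>measure_pmf.expectation (row_pmf (Q k) i) (\<phi> k) - 1 - t\<^sup>2 / 2 * \<theta>\<bar> \<le> C * e k"
    if k: "k \<ge> 1" and i: "i \<in> states" for k i
    unfolding \<phi>_def C_def e_def \<theta>(1)
  proof (rule pmf_mgf_estimate[OF K g m_K tK])
    show "0 \<le> \<delta> k" "0 \<le> \<epsilon> k" using \<delta> \<epsilon> k by auto
    show "\<bar>measure_pmf.expectation (row_pmf (Q k) i) g - m k\<bar> \<le> 2 * K * \<delta> k"
    proof -
      obtain n' where n': "k = Suc n'" using k by (cases k) auto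
      let ?E = "\<lambda>i. measure_pmf.expectation (row_pmf (Q k) i) g"
      have osc: "\<bar>?E i' - ?E i\<bar> \<le> 2 * K * \<delta> k" if "i' \<in> states" for i'
        unfolding \<delta>_def using that i g by (intro row_expectation_oscillation Q_stochastic k) auto
      have "?E i - 2 * K * \<delta> k \<le> m k"
        unfolding m_def n' using osc unfolding n' by (intro expectation_step_bounds[OF g, where u="?E i + 2 * K * \<delta> k"]) (force simp: n')+
      moreover have "m k \<le> ?E i + 2 * K * \<delta> k"
        unfolding m_def n' using osc unfolding n' by (intro expectation_step_bounds[OF g, where l="?E i - 2 * K * \<delta> k"]) (force simp: n')+
      ultimately show ?thesis by linarith
    qed
    show "\<bar>measure_pmf.expectation (row_pmf (Q k) i) g - measure_pmf.expectation p g\<bar> \<le> K * \<epsilon> k"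
      using row_expectation_near[OF Q_stochastic[OF k] P i, of g K] g by (simp add: \<epsilon>_def P_const[OF i])
    show "\<bar>measure_pmf.expectation (row_pmf (Q k) i) (\<lambda>x. (g x)\<^sup>2) - measure_pmf.expectation p (\<lambda>x. (g x)\<^sup>2)\<bar> \<le> K\<^sup>2 * \<epsilon> k"
    proof -
      have "\<bar>(g x)\<^sup>2\<bar> \<le> K\<^sup>2" for x using g[of x] K by (simp add: abs_le_square_iff[symmetric])
      then show ?thesis
        using row_expectation_near[OF Q_stochastic[OF k] P i, of "\<lambda>x. (g x)\<^sup>2" "K\<^sup>2"] by (simp add: \<epsilon>_def P_const[OF i])
    qed
  qed
  have "expectation S = (\<Sum>k=1..n. m k)" unfolding S_def m_def by (intro Bochner_Integration.integral_sum int_g)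
  then have exp_eq: "exp (t * (S \<omega> - expectation S)) = (\<Prod>k=1..n. \<phi> k (X k \<omega>))" for \<omega>
    by (simp add: S_def \<phi>_def exp_sum[symmetric] sum_distrib_left[symmetric] sum_subtractf)
  \<comment> \<open>The lower factors must be nonnegative for every index, also for \<open>0\<close>, where no transition gives a bound.\<close>
  define l u where "l k = (if k \<ge> 1 then 1 + t\<^sup>2 / 2 * \<theta> - C * e k else 0)" and "u k = 1 + t\<^sup>2 / 2 * \<theta> + C * e k" for k
  have ln_l: "0 < l k" "t\<^sup>2 / 2 * \<theta> - D * e k \<le> ln (l k)" if "k \<ge> 1" for k
    using ln_row_bounds[OF C1 \<theta>(2) \<delta>[OF that] \<epsilon>[OF that] t] that by (auto simp: l_def e_def D_def)
  have e0: "0 \<le> e k" if "k \<ge> 1" for k using \<delta>[OF that] \<epsilon>[OF that] by (simp add: e_def)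
  have u1: "1 \<le> u k" "ln (u k) \<le> t\<^sup>2 / 2 * \<theta> + D * e k" if "k \<ge> 1" for k
  proof -
    have "0 \<le> t\<^sup>2 / 2 * \<theta> + C * e k" using C1 e0[OF that] \<theta>(2) by simp
    then have "1 \<le> u k" "ln (u k) \<le> t\<^sup>2 / 2 * \<theta> + C * e k"
      using ln_add_one_self_le_self[of "t\<^sup>2 / 2 * \<theta> + C * e k"] by (auto simp: u_def add.assoc)
    moreover have "C * e k \<le> D * e k" using e0[OF that] by (intro mult_right_mono) (auto simp: D_def)
    ultimately show "1 \<le> u k" "ln (u k) \<le> t\<^sup>2 / 2 * \<theta> + D * e k" by linarith+
  qed
  have bounds: "(\<Prod>k=1..n. l k) \<le> expectation (\<lambda>\<omega>. \<Prod>k=1..n. \<phi> k (X k \<omega>))"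
    "expectation (\<lambda>\<omega>. \<Prod>k=1..n. \<phi> k (X k \<omega>)) \<le> (\<Prod>k=1..n. u k)"
  proof -
    have \<phi>0: "0 \<le> \<phi> k x" for k x by (simp add: \<phi>_def)
    have \<phi>B: "\<phi> k x \<le> exp (\<bar>t\<bar> * (2 * K))" for k x
    proof -
      have "\<bar>t * (g x - m k)\<bar> \<le> \<bar>t\<bar> * (2 * K)"
        unfolding abs_mult using g[of x] m_K[of k] by (intro mult_left_mono) auto
      then show ?thesis by (simp add: \<phi>_def)
    qed
    have l0: "0 \<le> l k" for k using ln_l(1)[of k] by (cases "k \<ge> 1") (auto simp: l_def)
    have rl: "l k \<le> measure_pmf.expectation (row_pmf (Q k) i) (\<phi> k)" if "k \<ge> 1" "i \<in> states" for k i
      using row[OF that] that by (simp add: l_def)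
    have ru: "measure_pmf.expectation (row_pmf (Q k) i) (\<phi> k) \<le> u k" if "k \<ge> 1" "i \<in> states" for k i
      using row[OF that] that by (simp add: u_def)
    show "(\<Prod>k=1..n. l k) \<le> expectation (\<lambda>\<omega>. \<Prod>k=1..n. \<phi> k (X k \<omega>))"
      "expectation (\<lambda>\<omega>. \<Prod>k=1..n. \<phi> k (X k \<omega>)) \<le> (\<Prod>k=1..n. u k)"
      using expectation_prod_bounds[where \<phi>=\<phi> and l=l and u=u and B="\<lambda>_. exp (\<bar>t\<bar> * (2 * K))", OF \<phi>0 \<phi>B l0 rl ru] by auto
  qed
  define E where "E = expectation (\<lambda>\<omega>. \<Prod>k=1..n. \<phi> k (X k \<omega>))"
  have l_pos: "0 < (\<Prod>k=1..n. l k)" using ln_l(1) by (intro prod_pos) auto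
  have sum_e: "(\<Sum>k=1..n. e k) = \<bar>t\<bar> * (\<Sum>k=1..n. \<delta> k) + t\<^sup>2 * (\<Sum>k=1..n. \<epsilon> k) + real n * \<bar>t\<bar> ^ 3"
    by (simp add: e_def sum.distrib sum_distrib_left)
  have "real n * (t\<^sup>2 / 2 * \<theta>) - D * (\<Sum>k=1..n. e k) = (\<Sum>k=1..n. t\<^sup>2 / 2 * \<theta> - D * e k)"
    by (simp add: sum_subtractf sum_distrib_left)
  also have "\<dots> \<le> (\<Sum>k=1..n. ln (l k))" using ln_l(2) by (intro sum_mono) auto
  also have "\<dots> = ln (\<Prod>k=1..n. l k)" using ln_l(1) by (subst ln_prod) force+
  also have "\<dots> \<le> ln E" using bounds(1) l_pos by (simp add: E_def)
  finally have lower: "real n * (t\<^sup>2 / 2 * \<theta>) - D * (\<Sum>k=1..n. e k) \<le> ln E" .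
  have "ln E \<le> ln (\<Prod>k=1..n. u k)" using bounds l_pos by (simp add: E_def)
  also have "\<dots> = (\<Sum>k=1..n. ln (u k))" using u1(1) by (subst ln_prod) force+
  also have "\<dots> \<le> (\<Sum>k=1..n. t\<^sup>2 / 2 * \<theta> + D * e k)" using u1(2) by (intro sum_mono) auto
  also have "\<dots> = real n * (t\<^sup>2 / 2 * \<theta>) + D * (\<Sum>k=1..n. e k)"
    by (simp add: sum.distrib sum_distrib_left)
  finally have "\<bar>ln E - real n * (t\<^sup>2 / 2 * \<theta>)\<bar> \<le> D * (\<Sum>k=1..n. e k)" using lower by linarith
  then show ?thesis unfolding exp_eq sum_e E_def D_def \<delta>_def \<epsilon>_def .
qed

end

section \<open>Equality of the rows of the limit matrix and the variance\<close>

text \<open>The single terms of the averages need not tend to \<open>0\<close>; but the left-hand side of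
  \<open>row_entry_diff_le\<close> is the same for every transition matrix, so that averaging that bound suffices.\<close>

lemma averages_tendsto_0_imp_equal_rows:
  assumes Q: "\<And>n. n \<ge> 1 \<Longrightarrow> stochastic_mat states (Q n)" and P: "stochastic_mat states P"
    and near: "(\<lambda>n. (\<Sum>k=1..n. mat_norm states (mat_diff (Q k) P)) / real n) \<longlonglongrightarrow> 0"
    and osc: "(\<lambda>n. (\<Sum>k=1..n. ergodic_coeff states (Q k)) / real n) \<longlonglongrightarrow> 0"
    and ijk: "i \<in> states" "k \<in> states" "j \<in> states"
  shows "P i j = P k j"
proof -
  let ?\<epsilon> = "\<lambda>k. mat_norm states (mat_diff (Q k) P)" and ?\<delta> = "\<lambda>k. ergodic_coeff states (Q k)"
  have "\<bar>P i j - P k j\<bar> \<le> 2 * ((\<Sum>k=1..n. ?\<epsilon> k) / real n) + 2 * ((\<Sum>k=1..n. ?\<delta> k) / real n)" if "n \<ge> 1" for n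
  proof -
    have "real n * \<bar>P i j - P k j\<bar> = (\<Sum>l=1..n. \<bar>P i j - P k j\<bar>)" by simp
    also have "\<dots> \<le> (\<Sum>l=1..n. 2 * ?\<epsilon> l + 2 * ?\<delta> l)"
      by (intro sum_mono row_entry_diff_le Q P ijk) auto
    also have "\<dots> = 2 * (\<Sum>l=1..n. ?\<epsilon> l) + 2 * (\<Sum>l=1..n. ?\<delta> l)"
      by (simp add: sum.distrib sum_distrib_left)
    finally show ?thesis using that by (simp add: field_simps)
  qed
  moreover have "(\<lambda>n. 2 * ((\<Sum>k=1..n. ?\<epsilon> k) / real n) + 2 * ((\<Sum>k=1..n. ?\<delta> k) / real n)) \<longlonglongrightarrow> 2 * 0 + 2 * 0"
    by (intro tendsto_intros near osc)
  ultimately have "\<bar>P i j - P k j\<bar> \<le> 0" by (intro LIMSEQ_le_const) auto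
  then show ?thesis by simp
qed

text \<open>If the rows of \<open>P\<close> agree, then \<open>\<pi> P = \<pi>\<close> says that their common value is \<open>\<pi>\<close>, and the inner sum is the
  same constant, the mean of \<open>g\<close>, for every state.\<close>

lemma theta_eq_variance:
  assumes P: "stochastic_mat states P"
    and pi_left: "\<And>j. j \<in> states \<Longrightarrow> ((\<lambda>i. \<pi> i * P i j) has_sum \<pi> j) states"
    and pi_sum: "(\<pi> has_sum 1) states"
    and rows: "\<And>i j. i \<in> states \<Longrightarrow> j \<in> states \<Longrightarrow> P i j = P 1 j"
    and g: "\<And>x. \<bar>g x\<bar> \<le> K"
  shows "(\<Sum>\<^sub>\<infinity>i\<in>states. \<pi> i * ((g i)\<^sup>2 - (\<Sum>\<^sub>\<infinity>j\<in>states. g j * P i j)\<^sup>2)) =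
     measure_pmf.expectation (row_pmf P 1) (\<lambda>x. (g x)\<^sup>2) - (measure_pmf.expectation (row_pmf P 1) g)\<^sup>2"
proof -
  let ?A = "measure_pmf.expectation (row_pmf P 1) g"
  have pi_P: "\<pi> j = P 1 j" if j: "j \<in> states" for j
  proof -
    have "((\<lambda>i. P 1 j * \<pi> i) has_sum P 1 j * 1) states" by (intro has_sum_cmult_right pi_sum)
    also have "((\<lambda>i. P 1 j * \<pi> i) has_sum P 1 j * 1) states \<longleftrightarrow> ((\<lambda>i. \<pi> i * P i j) has_sum P 1 j) states"
      unfolding mult_1_right by (intro has_sum_cong) (subst rows[OF _ j], assumption, rule mult.commute)
    finally show ?thesis using pi_left[OF j] has_sum_unique by blast
  qed
  have g2: "\<bar>(g x)\<^sup>2\<bar> \<le> K\<^sup>2" for x using power_mono[OF g[of x], of 2] by simp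
  have inner: "(\<Sum>\<^sub>\<infinity>j\<in>states. g j * P i j) = ?A" if "i \<in> states" for i
  proof -
    have "(\<Sum>\<^sub>\<infinity>j\<in>states. g j * P i j) = (\<Sum>\<^sub>\<infinity>j\<in>states. g j * P 1 j)"
      using rows[OF that] by (intro infsum_cong) simp
    also have "\<dots> = ?A" using P g by (intro infsum_eq_row_expectation) auto
    finally show ?thesis .
  qed
  have bd: "\<bar>(g x)\<^sup>2 - ?A\<^sup>2\<bar> \<le> K\<^sup>2 + ?A\<^sup>2" for x
    using abs_triangle_ineq4[of "(g x)\<^sup>2" "?A\<^sup>2"] g2[of x] by simp
  have "(\<Sum>\<^sub>\<infinity>i\<in>states. \<pi> i * ((g i)\<^sup>2 - (\<Sum>\<^sub>\<infinity>j\<in>states. g j * P i j)\<^sup>2)) =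
      (\<Sum>\<^sub>\<infinity>i\<in>states. ((g i)\<^sup>2 - ?A\<^sup>2) * P 1 i)"
    using inner pi_P by (intro infsum_cong) simp
  also have "\<dots> = measure_pmf.expectation (row_pmf P 1) (\<lambda>x. (g x)\<^sup>2 - ?A\<^sup>2)"
    using P bd by (intro infsum_eq_row_expectation) auto
  also have "\<dots> = measure_pmf.expectation (row_pmf P 1) (\<lambda>x. (g x)\<^sup>2) - ?A\<^sup>2"
    using bounded_integrable_pmf[of "\<lambda>x. (g x)\<^sup>2" "K\<^sup>2"] g2 by simp
  finally show ?thesis .
qed

section \<open>Moderate deviations\<close>

theorem theorem1p2:
  fixes M :: "'a measure" and X :: "nat \<Rightarrow> 'a \<Rightarrow> nat"
    and \<mu> \<pi> :: "nat \<Rightarrow> real" and Pn :: "nat \<Rightarrow> mat" and P R :: mat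
    and f :: "real \<Rightarrow> real" and K \<theta> :: real and a :: "nat \<Rightarrow> real"
  assumes chain: "markov_chain M X \<mu> Pn"
    and f_bounded: "\<And>x. \<bar>f x\<bar> \<le> K"
    and P_erg: "periodic_strongly_ergodic states P"
    and R_stoch: "stochastic_mat states R"
    and R_const: "constant_mat states R"
    and R_rows: "\<And>i j. i \<in> states \<Longrightarrow> j \<in> states \<Longrightarrow> R i j = \<pi> j"
    and pi_left: "\<And>j. j \<in> states \<Longrightarrow> ((\<lambda>i. \<pi> i * P i j) has_sum \<pi> j) states"
    and pi_sum: "(\<pi> has_sum 1) states"
    and P_conv: "(\<lambda>n. SUP m. (1 / real n) * (\<Sum>k=1..n. mat_norm states (mat_diff (Pn (k + m)) P)))
                   \<longlonglongrightarrow> 0"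
    and theta: "\<theta> = (\<Sum>\<^sub>\<infinity>i\<in>states. \<pi> i * ((f (real i))\<^sup>2 - (\<Sum>\<^sub>\<infinity>j\<in>states. f (real j) * P i j)\<^sup>2))"
    and theta_pos: "\<theta> > 0"
    and delta: "(\<lambda>n. (\<Sum>k=1..n. ergodic_coeff states (Pn k)) / sqrt (real n)) \<longlonglongrightarrow> 0"
    and a_sqrt: "filterlim (\<lambda>n. a n / sqrt (real n)) at_top sequentially"
    and a_lin: "(\<lambda>n. a n / real n) \<longlonglongrightarrow> 0"
  shows "(\<forall>G. open G \<longrightarrow>
            liminf (\<lambda>n. ereal (real n / (a n)\<^sup>2) *
              elog (\<P>(\<omega> in M. (partial_sum f X n \<omega> - (\<integral>\<omega>'. partial_sum f X n \<omega>' \<partial>M)) / a n \<in> G)))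
            \<ge> - (INF x\<in>G. ereal (rate_fun \<theta> x))) \<and>
         (\<forall>F. closed F \<longrightarrow>
            limsup (\<lambda>n. ereal (real n / (a n)\<^sup>2) *
              elog (\<P>(\<omega> in M. (partial_sum f X n \<omega> - (\<integral>\<omega>'. partial_sum f X n \<omega>' \<partial>M)) / a n \<in> F)))
            \<le> - (INF x\<in>F. ereal (rate_fun \<theta> x)))"
proof -
  interpret prob_space M using chain by (simp add: markov_chain_def)
  interpret nonhomogeneous_chain M X \<mu> Pn by unfold_locales (rule chain)
  have P: "stochastic_mat states P" using P_erg by (simp add: periodic_strongly_ergodic_def)
  \<comment> \<open>The estimates of the exponential need a bound that is at least \<open>1\<close>.\<close>
  define L where "L = max K 1"
  define g where "g i = f (real i)" for i :: nat
  have L1: "L \<ge> 1" and g: "\<bar>g x\<bar> \<le> L" for x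
    using f_bounded[of "real x"] by (auto simp: L_def g_def)
  define \<delta> \<epsilon> where "\<delta> k = ergodic_coeff states (Pn k)" and "\<epsilon> k = mat_norm states (mat_diff (Pn k) P)" for k
  have \<epsilon>: "0 \<le> \<epsilon> k" "\<epsilon> k \<le> 2" if "k \<ge> 1" for k
    using mat_norm_nonneg[OF Q_stochastic[OF that] P] row_dist_le_mat_norm(2)[OF Q_stochastic[OF that] P, of 1]
    by (auto simp: \<epsilon>_def)
  have \<epsilon>_avg: "(\<lambda>n. (\<Sum>k=1..n. \<epsilon> k) / real n) \<longlonglongrightarrow> 0"
  proof (rule tendsto_sandwich[OF _ _ tendsto_const P_conv])
    show "\<forall>\<^sub>F n in sequentially. 0 \<le> (\<Sum>k=1..n. \<epsilon> k) / real n"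
      using \<epsilon> by (intro always_eventually allI divide_nonneg_nonneg sum_nonneg) auto
    show "\<forall>\<^sub>F n in sequentially. (\<Sum>k=1..n. \<epsilon> k) / real n \<le>
        (SUP m. (1 / real n) * (\<Sum>k=1..n. mat_norm states (mat_diff (Pn (k + m)) P)))"
      using eventually_gt_at_top[of 0]
    proof eventually_elim
      case (elim n)
      have "bdd_above (range (\<lambda>m. (1 / real n) * (\<Sum>k=1..n. \<epsilon> (k + m))))"
      proof (rule bdd_aboveI2)
        fix m
        have "(\<Sum>k=1..n. \<epsilon> (k + m)) \<le> (\<Sum>k=1..n. 2)" using \<epsilon> by (intro sum_mono) auto
        then show "(1 / real n) * (\<Sum>k=1..n. \<epsilon> (k + m)) \<le> 2" using elim by (simp add: field_simps)
      qed
      from cSUP_upper[OF UNIV_I this, of 0] show ?case by (simp add: \<epsilon>_def)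
    qed
  qed
  have inv_sqrt: "(\<lambda>n. 1 / sqrt (real n)) \<longlonglongrightarrow> 0"
    by (intro tendsto_divide_0[OF tendsto_const] filterlim_at_top_imp_at_infinity
        filterlim_compose[OF sqrt_at_top filterlim_real_sequentially])
  have \<delta>_avg: "(\<lambda>n. (\<Sum>k=1..n. \<delta> k) / real n) \<longlonglongrightarrow> 0"
  proof -
    have "(\<lambda>n. ((\<Sum>k=1..n. \<delta> k) / sqrt (real n)) * (1 / sqrt (real n))) \<longlonglongrightarrow> 0 * 0"
      unfolding \<delta>_def by (intro tendsto_mult delta inv_sqrt)
    then show ?thesis by simp
  qed
  have rows: "P i j = P 1 j" if "i \<in> states" "j \<in> states" for i j
    using Q_stochastic P \<epsilon>_avg[unfolded \<epsilon>_def] \<delta>_avg[unfolded \<delta>_def] that(1) _ that(2)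
    by (rule averages_tendsto_0_imp_equal_rows[where Q=Pn]) auto
  have P_const: "row_pmf P i = row_pmf P 1" if "i \<in> states" for i
    using that P rows[OF that] by (intro pmf_eqI) (simp add: pmf_row_pmf)
  have \<theta>_var: "\<theta> = measure_pmf.expectation (row_pmf P 1) (\<lambda>x. (g x)\<^sup>2) - (measure_pmf.expectation (row_pmf P 1) g)\<^sup>2"
    unfolding theta using theta_eq_variance[where g=g and K=L, OF P pi_left pi_sum rows g]
    by (simp add: g_def)
  define b where "b n = (a n)\<^sup>2 / real n" for n
  define S where "S n \<omega> = (\<Sum>k=1..n. g (X k \<omega>))" for n \<omega>
  define Z where "Z n \<omega> = (S n \<omega> - expectation (S n)) / a n" for n \<omega>
  have S_meas[measurable]: "S n \<in> borel_measurable M" for n unfolding S_def by measurable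
  have S_bound: "\<bar>S n \<omega>\<bar> \<le> real n * L" for n \<omega>
  proof -
    have "\<bar>S n \<omega>\<bar> \<le> (\<Sum>k=1..n. \<bar>g (X k \<omega>)\<bar>)" unfolding S_def by (rule sum_abs)
    also have "\<dots> \<le> (\<Sum>k=1..n. L)" by (intro sum_mono g)
    finally show ?thesis by simp
  qed
  have a_pos: "\<forall>\<^sub>F n in sequentially. n > 0 \<and> a n > 0"
  proof -
    have "\<forall>\<^sub>F n in sequentially. a n / sqrt (real n) > 0"
      using a_sqrt by (simp add: filterlim_at_top_dense)
    then show ?thesis
      using eventually_gt_at_top[of 0] by eventually_elim (auto simp: zero_less_divide_iff)
  qed
  have speed: "filterlim b at_top sequentially"
  proof -
    have "filterlim (\<lambda>n. (a n / sqrt (real n)) * (a n / sqrt (real n))) at_top sequentially"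
      by (intro filterlim_at_top_mult_at_top a_sqrt)
    then show ?thesis unfolding b_def by (simp add: power2_eq_square)
  qed
  have log_mgf: "(\<lambda>n. ln (expectation (\<lambda>\<omega>. exp (l * b n * Z n \<omega>))) / b n) \<longlonglongrightarrow> \<theta> * l\<^sup>2 / 2" for l
  proof -
    define C where "C = 16 * L ^ 3"
    define D where "D = C + \<theta>\<^sup>2 + 16 * C\<^sup>2"
    define t where "t n = l * (a n / real n)" for n
    have t0: "t \<longlonglongrightarrow> 0" unfolding t_def using tendsto_mult[OF tendsto_const a_lin, of l] by simp
    have "(\<lambda>n. \<bar>t n\<bar> * (8 * C + \<theta>)) \<longlonglongrightarrow> \<bar>0\<bar> * (8 * C + \<theta>)"
      by (intro tendsto_intros t0)
    then have t_small: "\<forall>\<^sub>F n in sequentially. \<bar>t n\<bar> * (8 * C + \<theta>) < 1"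
      by (intro order_tendstoD) auto
    let ?err = "\<lambda>n. D * (\<bar>l\<bar> * (((\<Sum>k=1..n. \<delta> k) / sqrt (real n)) * (1 / (a n / sqrt (real n))))
       + l\<^sup>2 * ((\<Sum>k=1..n. \<epsilon> k) / real n) + \<bar>l\<bar> ^ 3 * \<bar>a n / real n\<bar>)"
    have "(\<lambda>n. 1 / (a n / sqrt (real n))) \<longlonglongrightarrow> 0"
      by (intro tendsto_divide_0[OF tendsto_const] filterlim_at_top_imp_at_infinity a_sqrt)
    then have "?err \<longlonglongrightarrow> D * (\<bar>l\<bar> * (0 * 0) + l\<^sup>2 * 0 + \<bar>l\<bar> ^ 3 * \<bar>0\<bar>)"
      by (intro tendsto_intros \<epsilon>_avg a_lin delta[folded \<delta>_def])
    then have err: "?err \<longlonglongrightarrow> 0" by simp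
    have "\<forall>\<^sub>F n in sequentially. norm (ln (expectation (\<lambda>\<omega>. exp (l * b n * Z n \<omega>))) / b n - \<theta> * l\<^sup>2 / 2) \<le> ?err n"
      using a_pos t_small
    proof eventually_elim
      case (elim n)
      then have n: "n > 0" "a n > 0" by auto
      have bn: "b n > 0" using n by (simp add: b_def)
      have bZ: "l * b n * Z n \<omega> = t n * (S n \<omega> - expectation (S n))" for \<omega>
        using n by (simp add: b_def Z_def t_def power2_eq_square)
      let ?l = "ln (expectation (\<lambda>\<omega>. exp (t n * (S n \<omega> - expectation (S n)))))"
      have est: "\<bar>?l - real n * ((t n)\<^sup>2 / 2 * \<theta>)\<bar> \<le>
        D * (\<bar>t n\<bar> * (\<Sum>k=1..n. \<delta> k) + (t n)\<^sup>2 * (\<Sum>k=1..n. \<epsilon> k) + real n * \<bar>t n\<bar> ^ 3)"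
        unfolding S_def[abs_def] D_def C_def \<delta>_def \<epsilon>_def
        using elim theta_pos
        by (intro centered_log_mgf_estimate[where p="row_pmf P 1"] L1 g P P_const \<theta>_var) (auto simp: C_def)
      have main: "real n * ((t n)\<^sup>2 / 2 * \<theta>) / b n = \<theta> * l\<^sup>2 / 2"
        using n by (simp add: t_def b_def power2_eq_square field_simps)
      have "\<bar>?l / b n - \<theta> * l\<^sup>2 / 2\<bar> = \<bar>?l - real n * ((t n)\<^sup>2 / 2 * \<theta>)\<bar> / b n"
        using bn unfolding main[symmetric] diff_divide_distrib[symmetric] abs_divide by (simp only: abs_of_pos)
      also have "\<dots> \<le> D * (\<bar>t n\<bar> * (\<Sum>k=1..n. \<delta> k) + (t n)\<^sup>2 * (\<Sum>k=1..n. \<epsilon> k) + real n * \<bar>t n\<bar> ^ 3) / b n"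
        using est bn by (intro divide_right_mono) auto
      also have "\<dots> = D * (\<bar>t n\<bar> / b n * (\<Sum>k=1..n. \<delta> k) + (t n)\<^sup>2 / b n * (\<Sum>k=1..n. \<epsilon> k) + real n * \<bar>t n\<bar> ^ 3 / b n)"
        by (simp only: times_divide_eq_right[symmetric] add_divide_distrib times_divide_eq_left)
      also have "\<bar>t n\<bar> / b n = \<bar>l\<bar> / a n"
        using n by (simp add: t_def b_def abs_mult power2_eq_square field_simps)
      also have "(t n)\<^sup>2 / b n = l\<^sup>2 / real n"
        using n by (simp add: t_def b_def power2_eq_square field_simps)
      also have "real n * \<bar>t n\<bar> ^ 3 / b n = \<bar>l\<bar> ^ 3 * \<bar>a n / real n\<bar>"
        using n by (simp add: t_def b_def abs_mult power_mult_distrib power2_eq_square power3_eq_cube field_simps)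
      also have "D * (\<bar>l\<bar> / a n * (\<Sum>k=1..n. \<delta> k) + l\<^sup>2 / real n * (\<Sum>k=1..n. \<epsilon> k) + \<bar>l\<bar> ^ 3 * \<bar>a n / real n\<bar>) = ?err n"
        using n by simp
      finally show ?case unfolding bZ by simp
    qed
    then have "(\<lambda>n. ln (expectation (\<lambda>\<omega>. exp (l * b n * Z n \<omega>))) / b n - \<theta> * l\<^sup>2 / 2) \<longlonglongrightarrow> 0"
      using err by (rule Lim_null_comparison)
    then show ?thesis by (rule LIM_zero_cancel)
  qed
  interpret gaussian_log_mgf M Z b \<theta>
  proof
    show "random_variable borel (Z n)" for n unfolding Z_def by measurable
    show "integrable M (\<lambda>\<omega>. exp (c * Z n \<omega>))" for n c
    proof (rule integrable_const_bound[where B="exp (\<bar>c\<bar> * ((real n * L + \<bar>expectation (S n)\<bar>) / \<bar>a n\<bar>))"])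
      have "c * Z n \<omega> \<le> \<bar>c\<bar> * ((real n * L + \<bar>expectation (S n)\<bar>) / \<bar>a n\<bar>)" for \<omega>
      proof -
        have "c * Z n \<omega> \<le> \<bar>c\<bar> * \<bar>Z n \<omega>\<bar>" by (simp add: abs_mult[symmetric])
        also have "\<bar>Z n \<omega>\<bar> \<le> (real n * L + \<bar>expectation (S n)\<bar>) / \<bar>a n\<bar>"
          unfolding Z_def abs_divide
          using S_bound[of n \<omega>] abs_triangle_ineq4[of "S n \<omega>" "expectation (S n)"] by (intro divide_right_mono) linarith+
        finally show ?thesis by (simp add: mult_left_mono)
      qed
      then show "AE \<omega> in M. norm (exp (c * Z n \<omega>)) \<le> exp (\<bar>c\<bar> * ((real n * L + \<bar>expectation (S n)\<bar>) / \<bar>a n\<bar>))" by simp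
      show "(\<lambda>\<omega>. exp (c * Z n \<omega>)) \<in> borel_measurable M" unfolding Z_def by measurable
    qed
  qed (use speed theta_pos log_mgf in auto)
  have S_eq: "S n = partial_sum f X n" for n by (simp add: fun_eq_iff S_def g_def partial_sum_def)
  have b_inv: "1 / b n = real n / (a n)\<^sup>2" for n by (simp add: b_def)
  show ?thesis
    using ldp_lower ldp_upper[OF borel_closed] unfolding b_inv Z_def S_eq by blast
qed

end
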